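(* Let $k\ge1$ be an integer. There exists an algorithm that, for any integral matrix $A\in\mathbb{Z}^{d\times n}$ with $\operatorname{cone}(A)$ pointed, computes a finite explicit representation of the set $\mathrm{Sg}_{<k}(A)$ of $k$-holes of the semigroup $\mathrm{Sg}(A)$. Namely, the algorithm computes finitely many vectors $h_i\in\mathbb{Z}^d$ and (affine) semigroups $M_i$, $i\in I$ ($I$ finite), each given by a finite set of generators in $\mathbb{Z}^d$ (possibly $M_i=\{0\}$), such that $$\mathrm{Sg}_{<k}(A)=\bigcup_{i\in I}(h_i+M_i).$$
   Context: $\operatorname{cone}(A)\subset\mathbb{R}^d$ is the cone of nonnegative real linear combinations of the columns of $A$, and $\mathrm{Sg}(A)=\{Ax:x\in\mathbb{Z}^n_{\ge0}\}$. $\mathrm{Sg}_{<k}(A)$ is the set of all $b\in\operatorname{cone}(A)\cap\mathbb{Z}^d$ for which there are fewer than $k$ distinct $x\in\mathbb{Z}^n_{\ge0}$ with $Ax=b$; its elements are called $k$-holes. Semigroups here contain the zero element. *)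

theory Defs
  imports
    "HOL-Library.Nat_Bijection"
    "Jordan_Normal_Form.Matrix"
begin

definition cone_of :: "int mat \<Rightarrow> real vec set" where
  "cone_of A = {map_mat real_of_int A *\<^sub>v x | x. x \<in> carrier_vec (dim_col A) \<and> 0\<^sub>v (dim_col A) \<le> x}"

definition pointed :: "real vec set \<Rightarrow> bool" where
  "pointed C \<longleftrightarrow> (\<forall>v. v \<in> C \<and> - v \<in> C \<longrightarrow> v = 0\<^sub>v (dim_vec v))"

definition fiber :: "int mat \<Rightarrow> int vec \<Rightarrow> int vec set" where
  "fiber A b = {x \<in> carrier_vec (dim_col A). 0\<^sub>v (dim_col A) \<le> x \<and> A *\<^sub>v x = b}"

definition Sg :: "int mat \<Rightarrow> int vec set" where
  "Sg A = {A *\<^sub>v x | x. x \<in> carrier_vec (dim_col A) \<and> 0\<^sub>v (dim_col A) \<le> x}"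

text \<open>Finiteness is required explicitly, since \<open>card\<close> of an infinite set is \<open>0\<close>
  and infinitely many solutions are not fewer than \<open>k\<close>.\<close>

definition Sg_less :: "nat \<Rightarrow> int mat \<Rightarrow> int vec set" where
  "Sg_less k A = {b \<in> carrier_vec (dim_row A).
     map_vec real_of_int b \<in> cone_of A \<and> finite (fiber A b) \<and> card (fiber A b) < k}"

text \<open>Algorithms are programs for partial recursive functions on the natural numbers.
  The relation \<open>rec_eval p xs y\<close> says that \<open>p\<close> halts on the arguments \<open>xs\<close> with result \<open>y\<close>.\<close>

datatype recf =
    Zero
  | Succ
  | Proj nat
  | Comp recf "recf list"
  | PrimRec recf recf
  | Mu recf

inductive rec_eval :: "recf \<Rightarrow> nat list \<Rightarrow> nat \<Rightarrow> bool" where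
  Zero: "rec_eval Zero xs 0"
| Succ: "rec_eval Succ [x] (Suc x)"
| Proj: "i < length xs \<Longrightarrow> rec_eval (Proj i) xs (xs ! i)"
| Comp: "list_all2 (\<lambda>g y. rec_eval g xs y) gs ys \<Longrightarrow> rec_eval f ys z
    \<Longrightarrow> rec_eval (Comp f gs) xs z"
| PrimRec_0: "rec_eval f xs y \<Longrightarrow> rec_eval (PrimRec f g) (0 # xs) y"
| PrimRec_Suc: "rec_eval (PrimRec f g) (n # xs) y \<Longrightarrow> rec_eval g (y # n # xs) z
    \<Longrightarrow> rec_eval (PrimRec f g) (Suc n # xs) z"
| Mu: "rec_eval f (n # xs) 0 \<Longrightarrow> (\<And>m. m < n \<Longrightarrow> \<exists>y. rec_eval f (m # xs) (Suc y))
    \<Longrightarrow> rec_eval (Mu f) xs n"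
  monos list_all2_mono

inductive_cases rec_eval_ZeroE: "rec_eval Zero xs y"
inductive_cases rec_eval_SuccE: "rec_eval Succ xs y"
inductive_cases rec_eval_ProjE: "rec_eval (Proj i) xs y"
inductive_cases rec_eval_CompE: "rec_eval (Comp f gs) xs y"
inductive_cases rec_eval_PrimRec_0E: "rec_eval (PrimRec f g) (0 # xs) y"
inductive_cases rec_eval_PrimRec_SucE: "rec_eval (PrimRec f g) (Suc n # xs) y"
inductive_cases rec_eval_MuE: "rec_eval (Mu f) xs y"

lemma rec_eval_deterministic:
  "rec_eval p xs y \<Longrightarrow> rec_eval p xs y' \<Longrightarrow> y = y'"
proof (induction arbitrary: y' rule: rec_eval.induct)
  case (Zero xs)
  then show ?case by (elim rec_eval_ZeroE) simp
next
  case (Succ x)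
  then show ?case by (elim rec_eval_SuccE) simp
next
  case (Proj i xs)
  then show ?case by (elim rec_eval_ProjE) simp
next
  case (PrimRec_0 f xs y g)
  then show ?case by (elim rec_eval_PrimRec_0E) blast
next
  case (Comp xs gs ys f z)
  from Comp.prems obtain ys' where
    ys': "list_all2 (\<lambda>g y. rec_eval g xs y) gs ys'" "rec_eval f ys' y'"
    by (rule rec_eval_CompE)
  have "ys = ys'"
  proof (rule nth_equalityI)
    show "length ys = length ys'"
      using Comp.IH(1) ys'(1) by (auto dest!: list_all2_lengthD)
    show "ys ! i = ys' ! i" if "i < length ys" for i
      using Comp.IH(1) ys'(1) that by (auto simp: list_all2_conv_all_nth)
  qed
  then show ?case using Comp.IH(2) ys'(2) by simp
next
  case (PrimRec_Suc f g n xs y z)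
  then show ?case by (elim rec_eval_PrimRec_SucE) blast
next
  case (Mu f n xs)
  from Mu.prems have n': "rec_eval f (y' # xs) 0"
      "\<And>m. m < y' \<Longrightarrow> \<exists>y. rec_eval f (m # xs) (Suc y)"
    by - (erule rec_eval_MuE, blast)+
  show ?case
  proof (rule linorder_cases[of n y'])
    assume "n < y'"
    with n'(2) obtain y where "rec_eval f (n # xs) (Suc y)" by blast
    with Mu.IH(1) show ?thesis by blast
  next
    assume "y' < n"
    with Mu.IH(2)[of y'] n'(1) show ?thesis by blast
  qed
qed

definition encode_vec :: "int vec \<Rightarrow> nat" where
  "encode_vec v = list_encode (map int_encode (list_of_vec v))"

definition encode_mat :: "int mat \<Rightarrow> nat" where
  "encode_mat A = prod_encode (dim_row A, list_encode (map encode_vec (cols A)))"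

text \<open>A list of pairs \<open>(h, G)\<close>, with \<open>G\<close> a list of vectors, stands for the union of the
  sets \<open>h + M\<close>, where \<open>M\<close> is the semigroup generated by \<open>G\<close>; the trivial semigroup
  is given by \<open>G = []\<close>.\<close>

type_synonym representation = "(int vec \<times> int vec list) list"

definition encode_rep :: "representation \<Rightarrow> nat" where
  "encode_rep R =
     list_encode (map (\<lambda>(h, G). prod_encode (encode_vec h, list_encode (map encode_vec G))) R)"

definition rep_wf :: "nat \<Rightarrow> representation \<Rightarrow> bool" where
  "rep_wf d R \<longleftrightarrow> (\<forall>(h, G) \<in> set R. h \<in> carrier_vec d \<and> set G \<subseteq> carrier_vec d)"

definition rep_set :: "nat \<Rightarrow> representation \<Rightarrow> int vec set" where
  "rep_set d R = (\<Union>(h, G) \<in> set R. {h + m | m. m \<in> Sg (mat_of_cols d G)})"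

lemma inj_encode_vec: "inj encode_vec"
proof (rule injI)
  fix v w assume "encode_vec v = encode_vec w"
  then have "list_of_vec v = list_of_vec w"
    by (simp add: encode_vec_def list_encode_eq inj_map_eq_map[OF inj_int_encode])
  then show "v = w" by (metis vec_list)
qed

lemma inj_encode_mat: "inj encode_mat"
proof (rule injI)
  fix A B assume "encode_mat A = encode_mat B"
  then have "dim_row A = dim_row B" "cols A = cols B"
    by (simp_all add: encode_mat_def prod_encode_eq list_encode_eq inj_map_eq_map[OF inj_encode_vec])
  then show "A = B" by (metis mat_of_cols_cols)
qed

lemma inj_encode_rep: "inj encode_rep"
proof -
  have "inj (\<lambda>(h, G). prod_encode (encode_vec h, list_encode (map encode_vec G)))"
    by (rule injI) (auto simp: prod_encode_eq list_encode_eq inj_eq[OF inj_encode_vec]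
        inj_map_eq_map[OF inj_encode_vec])
  then show ?thesis
    by (intro injI) (simp add: encode_rep_def list_encode_eq inj_map_eq_map)
qed

end

theory Submission
  imports "HOL-Analysis.Kronecker_Approximation_Theorem" Defs
begin

text \<open>Let \<open>A\<close> have \<open>n\<close> columns. Dirichlet's simultaneous approximation gives a number \<open>T\<close>, computable
  from \<open>A\<close>, with \<open>T b \<in> Sg A\<close> for every lattice point \<open>b\<close> of the cone. Hence every such \<open>b\<close> is of the
  form \<open>f + A x\<close> with \<open>x \<in> \<nat>\<^sup>n\<close> and \<open>f\<close> in the finite set of lattice points \<open>A u / T\<close>,
  \<open>u \<in> {0..<T}\<^sup>n\<close>. For fixed \<open>f\<close> the vectors \<open>x\<close> such that \<open>f + A x\<close> has at least \<open>k\<close>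
  preimages form an up-closed subset of \<open>\<nat>\<^sup>n\<close>. Being minimal in it is controlled by a homogeneous
  linear system in \<open>x\<close> and \<open>k\<close> pairwise distinct preimages, and every solution of such a system over
  \<open>\<nat>\<close> is a sum of solutions bounded by a computable \<open>B\<close>; so the minimal elements, along with \<open>k\<close>
  preimages each, lie in \<open>{0..B}\<^sup>n\<close>. The complement of the up-closed set is then the union of the
  sets \<open>x + \<nat>\<^sup>S\<close> with \<open>x \<in> {0..B}\<^sup>n\<close> and \<open>S = {j. x\<^sub>j = B}\<close> for which \<open>f + A x\<close> has fewer than
  \<open>k\<close> preimages in \<open>{0..2 B}\<^sup>n\<close>, and it can be listed by exhaustive search.\<close>

section \<open>Programs for the pairing function\<close>

definition add_prog :: recf where
  "add_prog = PrimRec (Proj 0) (Comp Succ [Proj 0])"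

definition pred_prog :: recf where
  "pred_prog = PrimRec Zero (Proj 1)"

text \<open>Recursion runs on the first argument, so the subtrahend comes first:
  \<open>[m, n]\<close> is sent to \<open>n - m\<close>.\<close>

definition sub_prog :: recf where
  "sub_prog = PrimRec (Proj 0) (Comp pred_prog [Proj 0])"

definition triangle_prog :: recf where
  "triangle_prog = PrimRec Zero (Comp add_prog [Proj 0, Comp Succ [Proj 1]])"

definition pair_prog :: recf where
  "pair_prog = Comp add_prog [Comp triangle_prog [add_prog], Proj 0]"

definition diagonal_prog :: recf where
  "diagonal_prog = Mu (Comp sub_prog [Comp triangle_prog [Comp Succ [Proj 0]], Comp Succ [Proj 1]])"

definition fst_prog :: recf where
  "fst_prog = Comp sub_prog [Comp triangle_prog [diagonal_prog], Proj 0]"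

definition snd_prog :: recf where
  "snd_prog = Comp sub_prog [fst_prog, diagonal_prog]"

lemma rec_eval_Proj: "i < length xs \<Longrightarrow> y = xs ! i \<Longrightarrow> rec_eval (Proj i) xs y"
  using rec_eval.Proj by simp

lemma rec_eval_Comp1: "rec_eval g xs y \<Longrightarrow> rec_eval f [y] z \<Longrightarrow> rec_eval (Comp f [g]) xs z"
  by (rule rec_eval.Comp[where ys = "[y]"]) auto

lemma rec_eval_Comp2:
  "rec_eval g xs y \<Longrightarrow> rec_eval h xs y' \<Longrightarrow> rec_eval f [y, y'] z \<Longrightarrow> rec_eval (Comp f [g, h]) xs z"
  by (rule rec_eval.Comp[where ys = "[y, y']"]) auto

lemma rec_eval_PrimRec:
  assumes "rec_eval f xs (r 0)" and "\<And>m. m < n \<Longrightarrow> rec_eval g (r m # m # xs) (r (Suc m))"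
  shows "rec_eval (PrimRec f g) (n # xs) (r n)"
  using assms by (induction n) (auto intro: rec_eval.intros)

lemma rec_eval_add_prog: "rec_eval add_prog [m, n] (m + n)"
  unfolding add_prog_def
  by (rule rec_eval_PrimRec[where r = "\<lambda>m. m + n"])
     (auto intro!: rec_eval_Proj rec_eval_Comp1 rec_eval.Succ)

lemma rec_eval_pred_prog: "rec_eval pred_prog [n] (n - 1)"
  unfolding pred_prog_def
  by (rule rec_eval_PrimRec[where r = "\<lambda>n. n - 1"]) (auto intro!: rec_eval_Proj rec_eval.Zero)

lemma rec_eval_sub_prog: "rec_eval sub_prog [m, n] (n - m)"
  unfolding sub_prog_def
proof (rule rec_eval_PrimRec[where r = "\<lambda>m. n - m"])
  fix m
  have "rec_eval pred_prog [n - m] (n - Suc m)" using rec_eval_pred_prog[of "n - m"] by simp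
  then show "rec_eval (Comp pred_prog [Proj 0]) [n - m, m, n] (n - Suc m)"
    by (auto intro!: rec_eval_Comp1 rec_eval_Proj)
qed (auto intro!: rec_eval_Proj)

lemma rec_eval_triangle_prog: "rec_eval triangle_prog [n] (triangle n)"
  unfolding triangle_prog_def
proof (rule rec_eval_PrimRec[where r = triangle])
  fix m
  show "rec_eval (Comp add_prog [Proj 0, Comp Succ [Proj 1]]) [triangle m, m] (triangle (Suc m))"
    using rec_eval_add_prog[of "triangle m" "Suc m"]
    by (auto intro!: rec_eval_Comp1 rec_eval_Comp2 rec_eval_Proj rec_eval.Succ)
qed (auto intro!: rec_eval.Zero)

lemma rec_eval_pair_prog: "rec_eval pair_prog [m, n] (prod_encode (m, n))"
  unfolding pair_prog_def prod_encode_def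
  by (auto intro!: rec_eval_Comp1 rec_eval_Comp2 rec_eval_Proj rec_eval_add_prog
      rec_eval_triangle_prog)

lemma triangle_mono: "m \<le> n \<Longrightarrow> triangle m \<le> triangle n"
  by (rule lift_Suc_mono_le) auto

text \<open>The diagonal \<open>m + n\<close> of a pair is the least \<open>s\<close> whose successor's triangle number exceeds
  the code of the pair.\<close>

lemma rec_eval_diagonal_prog: "rec_eval diagonal_prog [prod_encode (m, n)] (m + n)"
  unfolding diagonal_prog_def
proof (rule rec_eval.Mu)
  let ?z = "prod_encode (m, n)"
  have step: "rec_eval (Comp sub_prog [Comp triangle_prog [Comp Succ [Proj 0]], Comp Succ [Proj 1]])
      (s # [?z]) (Suc ?z - triangle (Suc s))" for s
    by (auto intro!: rec_eval_Comp1 rec_eval_Comp2 rec_eval_Proj rec_eval.Succ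
        rec_eval_triangle_prog rec_eval_sub_prog simp del: triangle_Suc)
  have "Suc ?z - triangle (Suc (m + n)) = 0"
    by (simp add: prod_encode_def)
  then show "rec_eval (Comp sub_prog [Comp triangle_prog [Comp Succ [Proj 0]], Comp Succ [Proj 1]])
      ((m + n) # [?z]) 0"
    using step[of "m + n"] by simp
  fix s assume "s < m + n"
  then have "triangle (Suc s) \<le> ?z"
    using triangle_mono[of "Suc s" "m + n"] by (simp add: prod_encode_def del: triangle_Suc)
  then have "Suc ?z - triangle (Suc s) = Suc (?z - triangle (Suc s))"
    by simp
  then show "\<exists>y. rec_eval (Comp sub_prog [Comp triangle_prog [Comp Succ [Proj 0]],
      Comp Succ [Proj 1]]) (s # [?z]) (Suc y)"
    using step[of s] by metis
qed

lemma rec_eval_fst_prog: "rec_eval fst_prog [prod_encode (m, n)] m"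
proof -
  have "prod_encode (m, n) - triangle (m + n) = m" by (simp add: prod_encode_def)
  then have "rec_eval sub_prog [triangle (m + n), prod_encode (m, n)] m"
    using rec_eval_sub_prog[of "triangle (m + n)" "prod_encode (m, n)"] by simp
  then show ?thesis
    unfolding fst_prog_def
    by (auto intro!: rec_eval_Comp1[OF rec_eval_diagonal_prog] rec_eval_Comp2 rec_eval_Proj
        rec_eval_triangle_prog)
qed

lemma rec_eval_snd_prog: "rec_eval snd_prog [prod_encode (m, n)] n"
  using rec_eval_sub_prog[of m "m + n"] unfolding snd_prog_def
  by (auto intro!: rec_eval_Comp2[OF rec_eval_fst_prog rec_eval_diagonal_prog])

section \<open>Computable functions between encodable types\<close>

text \<open>Bijectivity makes \<open>decode\<close> a two-sided inverse, so every function on codes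
  is also a function on values, and passing between a value and its code costs no
  computation.\<close>

class encodable =
  fixes encode :: "'a \<Rightarrow> nat"
  assumes bij_encode: "bij encode"
begin

definition decode :: "nat \<Rightarrow> 'a" where
  "decode = inv_into UNIV encode"

lemma encode_decode [simp]: "encode (decode n) = n"
  unfolding decode_def using bij_encode by (simp add: bij_is_surj surj_f_inv_f)

lemma decode_encode [simp]: "decode (encode x) = x"
  unfolding decode_def using bij_encode by (simp add: bij_is_inj)

lemma encode_eq_iff [simp]: "encode x = encode y \<longleftrightarrow> x = y"
  using bij_encode by (simp add: bij_is_inj inj_eq)

end

instantiation nat :: encodable
begin
definition encode_nat :: "nat \<Rightarrow> nat" where "encode_nat n = n"
instance by standard (simp add: encode_nat_def[abs_def] bij_id[unfolded id_def])
end

text \<open>For integers, pairs and lists the codes are built as in \<open>encode_mat\<close> and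
  \<open>encode_rep\<close>, so that programs for lists act on matrices without conversion.\<close>

instantiation int :: encodable
begin
definition encode_int :: "int \<Rightarrow> nat" where "encode_int = int_encode"
instance by standard (simp add: encode_int_def bij_int_encode)
end

instantiation prod :: (encodable, encodable) encodable
begin
definition encode_prod :: "'a \<times> 'b \<Rightarrow> nat" where
  "encode_prod p = prod_encode (map_prod encode encode p)"
instance
proof
  have "prod_encode (map_prod encode encode (map_prod (decode :: nat \<Rightarrow> 'a) (decode :: nat \<Rightarrow> 'b)
      (prod_decode n))) = n" for n
    using prod_decode_inverse[of n] by (cases "prod_decode n") simp
  then show "bij (encode :: 'a \<times> 'b \<Rightarrow> nat)"
    by (intro o_bij[where g = "\<lambda>n. map_prod decode decode (prod_decode n)"])
       (auto simp: encode_prod_def fun_eq_iff)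
qed
end

instantiation list :: (encodable) encodable
begin
definition encode_list :: "'a list \<Rightarrow> nat" where
  "encode_list xs = list_encode (map encode xs)"
instance
proof
  show "bij (encode :: 'a list \<Rightarrow> nat)"
    by (rule o_bij[where g = "\<lambda>n. map decode (list_decode n)"])
       (auto simp: encode_list_def fun_eq_iff comp_def)
qed
end

lemma encode_nat [simp]: "encode (n :: nat) = n"
  by (simp add: encode_nat_def)

lemma encode_Pair: "encode (x, y) = prod_encode (encode x, encode y)"
  by (simp add: encode_prod_def)

lemma encode_Nil: "encode [] = 0"
  by (simp add: encode_list_def)

lemma encode_Cons: "encode (x # xs) = Suc (encode (x, xs))"
  by (simp add: encode_list_def encode_Pair)

text \<open>One program has to be correct on all values, so \<open>f\<close> is total recursive.
  Several arguments are passed as nested pairs, which explains \<open>fst\<close> and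
  \<open>snd\<close> in the closure rules.\<close>

definition computable :: "('a::encodable \<Rightarrow> 'b::encodable) \<Rightarrow> bool" where
  "computable f \<longleftrightarrow> (\<exists>p. \<forall>x. rec_eval p [encode x] (encode (f x)))"

definition decidable :: "('a::encodable \<Rightarrow> bool) \<Rightarrow> bool" where
  "decidable P \<longleftrightarrow> computable (\<lambda>x. of_bool (P x) :: nat)"

named_theorems computable_intros

lemma computable_id [computable_intros]: "computable (\<lambda>x. x)"
  unfolding computable_def by (auto intro!: exI[of _ "Proj 0"] rec_eval_Proj)

lemma computable_const [computable_intros]: "computable (\<lambda>x. c)"
proof -
  have "\<exists>p. \<forall>x. rec_eval p [x] n" for n
  proof (induction n)
    case (Suc n)
    then show ?case by (meson rec_eval_Comp1 rec_eval.Succ)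
  qed (auto intro: rec_eval.Zero)
  then show ?thesis unfolding computable_def by meson
qed

lemma computable_comp:
  assumes "computable f" and "computable g"
  shows "computable (\<lambda>x. f (g x))"
  using assms unfolding computable_def by (meson rec_eval_Comp1)

lemma computable_Pair [computable_intros]:
  assumes "computable f" and "computable g"
  shows "computable (\<lambda>x. (f x, g x))"
  using assms unfolding computable_def encode_Pair by (meson rec_eval_Comp2 rec_eval_pair_prog)

lemma computable_fst [computable_intros]:
  assumes "computable f"
  shows "computable (\<lambda>x. fst (f x))"
proof -
  have "computable (fst :: 'b \<times> 'c \<Rightarrow> 'b)"
    unfolding computable_def using rec_eval_fst_prog by (auto simp: encode_Pair)
  from computable_comp[OF this assms] show ?thesis .
qed

lemma computable_snd [computable_intros]:
  assumes "computable f"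
  shows "computable (\<lambda>x. snd (f x))"
proof -
  have "computable (snd :: 'b \<times> 'c \<Rightarrow> 'c)"
    unfolding computable_def using rec_eval_snd_prog by (auto simp: encode_Pair)
  from computable_comp[OF this assms] show ?thesis .
qed

lemma computable_encode:
  assumes "computable f"
  shows "computable (\<lambda>x. encode (f x))"
  using assms unfolding computable_def by simp

lemma computable_decode:
  assumes "computable f"
  shows "computable (\<lambda>x. decode (f x))"
  using assms unfolding computable_def by simp

lemma computable_Suc [computable_intros]:
  assumes "computable f"
  shows "computable (\<lambda>x. Suc (f x))"
  using assms unfolding computable_def encode_nat by (meson rec_eval_Comp1 rec_eval.Succ)

lemma computable_rec_nat [computable_intros]:
  assumes "computable n" and "computable f"
    and "computable (\<lambda>p. g (fst p) (fst (snd p)) (snd (snd p)))"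
  shows "computable (\<lambda>x. rec_nat (f x) (g x) (n x))"
proof -
  obtain pn pf pg where pn: "\<And>x. rec_eval pn [encode x] (n x)"
    and pf: "\<And>x. rec_eval pf [encode x] (encode (f x))"
    and pg: "\<And>x m r. rec_eval pg [encode (x, m, r)] (encode (g x m r))"
    using assms unfolding computable_def encode_nat by (metis fst_conv snd_conv)
  \<comment> \<open>The step of a primitive recursion receives result, counter, parameter in this
    order; they are repacked into the code of the triple \<open>(x, m, r)\<close> that
    \<open>pg\<close> expects.\<close>
  let ?G = "Comp pg [Comp pair_prog [Proj 2, Comp pair_prog [Proj 1, Proj 0]]]"
  have step: "rec_eval ?G [encode r, m, encode x] (encode (g x m r))" for r m x
    using pg[of x m r] unfolding encode_Pair encode_nat
    by (auto intro!: rec_eval_Comp1 rec_eval_Comp2 rec_eval_Proj rec_eval_pair_prog)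
  have "rec_eval (PrimRec pf ?G) (m # [encode x]) (encode (rec_nat (f x) (g x) m))" for x m
    by (rule rec_eval_PrimRec[where r = "\<lambda>m. encode (rec_nat (f x) (g x) m)"])
       (use pf step in auto)
  then have "rec_eval (Comp (PrimRec pf ?G) [pn, Proj 0]) [encode x]
      (encode (rec_nat (f x) (g x) (n x)))" for x
    using pn by (auto intro!: rec_eval_Comp2 rec_eval_Proj)
  then show ?thesis
    unfolding computable_def by blast
qed

text \<open>A case distinction is a recursion whose step ignores the previous result.\<close>

lemma computable_case_nat [computable_intros]:
  assumes "computable n" and "computable f" and "computable (\<lambda>p. g (fst p) (snd p))"
  shows "computable (\<lambda>x. case n x of 0 \<Rightarrow> f x | Suc m \<Rightarrow> g x m)"
proof -
  have "computable (\<lambda>p. g (fst p) (fst (snd p)))"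
    using computable_comp[OF assms(3), of "\<lambda>p. (fst p, fst (snd p))"]
    by (simp add: computable_intros)
  then have "computable (\<lambda>x. rec_nat (f x) (\<lambda>m r. g x m) (n x))"
    by (intro computable_rec_nat assms)
  moreover have "rec_nat (f x) (\<lambda>m r. g x m) (n x) = (case n x of 0 \<Rightarrow> f x | Suc m \<Rightarrow> g x m)" for x
    by (cases "n x") auto
  ultimately show ?thesis by simp
qed

lemma computable_If [computable_intros]:
  assumes "decidable P" and "computable f" and "computable g"
  shows "computable (\<lambda>x. if P x then f x else g x)"
proof -
  have "computable (\<lambda>x. case of_bool (P x) :: nat of 0 \<Rightarrow> g x | Suc m \<Rightarrow> f x)"
    using assms computable_comp[OF assms(2) computable_fst[OF computable_id]]
    unfolding decidable_def by (intro computable_case_nat)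
  moreover have "(case of_bool (P x) :: nat of 0 \<Rightarrow> g x | Suc m \<Rightarrow> f x)
      = (if P x then f x else g x)" for x
    by auto
  ultimately show ?thesis by simp
qed

lemma decidable_if:
  assumes "decidable P" and "decidable Q" and "decidable R"
  shows "decidable (\<lambda>x. if P x then Q x else R x)"
proof -
  have "computable (\<lambda>x. if P x then of_bool (Q x) else of_bool (R x) :: nat)"
    using assms by (intro computable_If) (simp_all add: decidable_def)
  moreover have "(if P x then of_bool (Q x) else of_bool (R x))
      = (of_bool (if P x then Q x else R x) :: nat)" for x
    by simp
  ultimately show ?thesis unfolding decidable_def by simp
qed

lemma decidable_const [computable_intros]: "decidable (\<lambda>x. b)"
  unfolding decidable_def by (rule computable_const)

lemma decidable_conj [computable_intros]:
  assumes "decidable P" and "decidable Q"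
  shows "decidable (\<lambda>x. P x \<and> Q x)"
proof -
  have "(\<lambda>x. if P x then Q x else False) = (\<lambda>x. P x \<and> Q x)" by auto
  with decidable_if[OF assms decidable_const[of False]] show ?thesis by simp
qed

lemma decidable_all [computable_intros]:
  assumes "computable n" and "decidable (\<lambda>p. P (fst p) (snd p))"
  shows "decidable (\<lambda>x. \<forall>i < n x. P x (i::nat))"
proof -
  have "decidable (\<lambda>p. P (fst p) (fst (snd p)))"
    using computable_comp[OF assms(2)[unfolded decidable_def], of "\<lambda>p. (fst p, fst (snd p))"]
    by (simp add: computable_intros decidable_def)
  then have "computable (\<lambda>x. rec_nat (1::nat) (\<lambda>i r. if P x i then r else 0) (n x))"
    by (intro computable_intros assms)
  moreover have "rec_nat (1::nat) (\<lambda>i r. if P x i then r else 0) m = of_bool (\<forall>i<m. P x i)" for x m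
    by (induction m) (auto simp: less_Suc_eq)
  ultimately show ?thesis unfolding decidable_def by simp
qed

section \<open>Arithmetic and comparison of natural numbers\<close>

lemma computable_plus_nat [computable_intros]:
  fixes f g :: "'a::encodable \<Rightarrow> nat"
  assumes "computable f" and "computable g"
  shows "computable (\<lambda>x. f x + g x)"
  using assms unfolding computable_def encode_nat by (meson rec_eval_Comp2 rec_eval_add_prog)

lemma computable_minus_nat [computable_intros]:
  fixes f g :: "'a::encodable \<Rightarrow> nat"
  assumes "computable f" and "computable g"
  shows "computable (\<lambda>x. f x - g x)"
  using assms unfolding computable_def encode_nat by (meson rec_eval_Comp2 rec_eval_sub_prog)

lemma computable_times_nat [computable_intros]:
  fixes f g :: "'a::encodable \<Rightarrow> nat"
  assumes "computable f" and "computable g"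
  shows "computable (\<lambda>x. f x * g x)"
proof -
  have "computable (\<lambda>x. rec_nat 0 (\<lambda>_ r. r + g x) (f x))"
    by (intro computable_intros assms computable_comp[OF assms(2)])
  moreover have "rec_nat 0 (\<lambda>_ r. r + g x) m = m * g x" for x m
    by (induction m) auto
  ultimately show ?thesis by simp
qed

lemma computable_power_nat [computable_intros]:
  fixes f g :: "'a::encodable \<Rightarrow> nat"
  assumes "computable f" and "computable g"
  shows "computable (\<lambda>x. f x ^ g x)"
proof -
  have "computable (\<lambda>x. rec_nat 1 (\<lambda>_ r. f x * r) (g x))"
    by (intro computable_intros assms computable_comp[OF assms(1)])
  moreover have "rec_nat 1 (\<lambda>_ r. f x * r) m = f x ^ m" for x m
    by (induction m) auto
  ultimately show ?thesis by simp
qed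

lemma computable_fact_nat [computable_intros]:
  assumes "computable f"
  shows "computable (\<lambda>x. fact (f x) :: nat)"
proof -
  have "computable (\<lambda>x. rec_nat (1::nat) (\<lambda>m r. Suc m * r) (f x))"
    by (intro computable_intros assms)
  moreover have "rec_nat (1::nat) (\<lambda>m r. Suc m * r) m = fact m" for m
    by (induction m) auto
  ultimately show ?thesis by simp
qed

lemma decidable_le_nat [computable_intros]:
  fixes f g :: "'a::encodable \<Rightarrow> nat"
  assumes "computable f" and "computable g"
  shows "decidable (\<lambda>x. f x \<le> g x)"
proof -
  have "computable (\<lambda>x. 1 - (f x - g x))"
    by (intro computable_intros assms)
  moreover have "1 - (m - n) = of_bool (m \<le> n)" for m n :: nat
    by auto
  ultimately show ?thesis unfolding decidable_def by simp
qed

lemma decidable_less_nat [computable_intros]: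
  fixes f g :: "'a::encodable \<Rightarrow> nat"
  assumes "computable f" and "computable g"
  shows "decidable (\<lambda>x. f x < g x)"
  using decidable_le_nat[OF computable_Suc[OF assms(1)] assms(2)] by (simp add: Suc_le_eq)

lemma decidable_eq [computable_intros]:
  assumes "computable f" and "computable g"
  shows "decidable (\<lambda>x. f x = g x)"
proof -
  have "decidable (\<lambda>x. encode (f x) \<le> encode (g x) \<and> encode (g x) \<le> encode (f x))"
    by (intro computable_intros computable_encode assms)
  then show ?thesis by (simp flip: eq_iff)
qed

lemma computable_half: 
  assumes "computable f"
  shows "computable (\<lambda>x. f x div (2::nat))" and "decidable (\<lambda>x. even (f x))"
proof -
  have ev: "computable (\<lambda>x. rec_nat (1::nat) (\<lambda>_ r. 1 - r) (f x))" if "computable f"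
    for f :: "'b::encodable \<Rightarrow> nat"
    by (intro computable_intros that)
  have eq: "rec_nat (1::nat) (\<lambda>_ r. 1 - r) m = of_bool (even m)" for m
    by (induction m) auto
  \<comment> \<open>Proved for arbitrary \<open>f\<close>, since the halving loop below tests the
    parity of its own counter.\<close>
  have even: "decidable (\<lambda>x. even (f x))" if "computable f" for f :: "'b::encodable \<Rightarrow> nat"
    using ev[OF that] unfolding eq decidable_def .
  from even[OF assms] show "decidable (\<lambda>x. even (f x))" .
  have "computable (\<lambda>x. rec_nat (0::nat) (\<lambda>m r. if even m then r else Suc r) (f x))"
    by (intro computable_intros even assms)
  moreover have "rec_nat (0::nat) (\<lambda>m r. if even m then r else Suc r) m = m div 2" for m
    by (induction m) auto
  ultimately show "computable (\<lambda>x. f x div (2::nat))" by simp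
qed

section \<open>Lists\<close>

lemma computable_Cons [computable_intros]:
  assumes "computable f" and "computable g"
  shows "computable (\<lambda>x. f x # g x)"
proof -
  have "computable (\<lambda>x. decode (Suc (encode (f x, g x))) :: 'b list)"
    by (intro computable_decode computable_Suc computable_encode computable_Pair assms)
  then show ?thesis by (simp flip: encode_Cons)
qed

lemma computable_case_list:
  assumes "computable l" and "computable f"
    and "computable (\<lambda>p. g (fst p) (fst (snd p)) (snd (snd p)))"
  shows "computable (\<lambda>x. case l x of [] \<Rightarrow> f x | y # ys \<Rightarrow> g x y ys)"
proof -
  have "computable (\<lambda>p. (fst p, decode (snd p) :: 'b \<times> 'b list))"
    by (intro computable_intros computable_decode)
  from computable_comp[OF assms(3) this]
  have "computable (\<lambda>x. case encode (l x) of 0 \<Rightarrow> f x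
      | Suc m \<Rightarrow> g x (fst (decode m :: 'b \<times> 'b list)) (snd (decode m :: 'b \<times> 'b list)))"
    by (intro computable_case_nat computable_encode assms) simp
  moreover have "(case encode (l x) of 0 \<Rightarrow> f x
      | Suc m \<Rightarrow> g x (fst (decode m :: 'b \<times> 'b list)) (snd (decode m :: 'b \<times> 'b list)))
      = (case l x of [] \<Rightarrow> f x | y # ys \<Rightarrow> g x y ys)" for x
    by (cases "l x") (auto simp: encode_Nil encode_Cons)
  ultimately show ?thesis by simp
qed

lemma computable_tl:
  assumes "computable l"
  shows "computable (\<lambda>x. tl (l x))"
proof -
  have "computable (\<lambda>x. case l x of [] \<Rightarrow> [] | y # ys \<Rightarrow> ys)"
    by (intro computable_case_list computable_intros assms)
  moreover have "(case xs of [] \<Rightarrow> [] | y # ys \<Rightarrow> ys) = tl xs" for xs :: "'b list"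
    by (cases xs) auto
  ultimately show ?thesis by simp
qed

lemma length_le_encode: "length xs \<le> encode xs"
proof (induction xs)
  case (Cons x xs)
  moreover have "encode xs \<le> encode (x, xs)"
    by (simp add: encode_Pair le_prod_encode_2)
  ultimately show ?case by (simp add: encode_Cons)
qed simp

text \<open>The code of a list bounds its length, so folding is a loop whose number of rounds is known
  in advance; the rounds after the list is exhausted are idle.\<close>

lemma computable_foldl:
  assumes "computable l" and "computable f"
    and g: "computable (\<lambda>p. g (fst p) (fst (snd p)) (snd (snd p)))"
  shows "computable (\<lambda>x. foldl (g x) (f x) (l x))"
proof -
  define step where "step x s = (case snd s of [] \<Rightarrow> s | y # ys \<Rightarrow> (g x (fst s) y, ys))"
    for x and s :: "'c \<times> 'b list"
  have "computable (\<lambda>p. g (fst (fst p)) (fst (snd (snd (fst p)))) (fst (snd p)))"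
    using computable_comp[OF g, of "\<lambda>p. (fst (fst p), fst (snd (snd (fst p))), fst (snd p))"]
    by (simp add: computable_intros)
  then have "computable (\<lambda>x. rec_nat (f x, l x) (\<lambda>m s. step x s) (encode (l x)))"
    unfolding step_def
    by (intro computable_rec_nat computable_case_list computable_intros computable_encode assms)
  then have comp: "computable (\<lambda>x. fst (rec_nat (f x, l x) (\<lambda>m s. step x s) (encode (l x))))"
    by (rule computable_fst)
  have idle: "rec_nat (a, []) (\<lambda>m s. step x s) m = (a, [])" for x a m
    by (induction m) (auto simp: step_def)
  \<comment> \<open>\<open>rec_nat\<close> unfolds its last round, whereas the list is consumed from
    the front; so the first round is split off instead.\<close>
  have shift: "rec_nat s (\<lambda>m s. step x s) (Suc m) = rec_nat (step x s) (\<lambda>m s. step x s) m" for x s m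
    by (induction m) auto
  have "fst (rec_nat (a, xs) (\<lambda>m s. step x s) m) = foldl (g x) a xs" if "length xs \<le> m" for x a xs m
    using that
  proof (induction xs arbitrary: a m)
    case Nil
    then show ?case by (simp add: idle)
  next
    case (Cons y ys)
    then obtain m' where "m = Suc m'" by (cases m) auto
    have "step x (a, y # ys) = (g x a y, ys)" by (simp add: step_def)
    then have "rec_nat (a, y # ys) (\<lambda>m s. step x s) m = rec_nat (g x a y, ys) (\<lambda>m s. step x s) m'"
      unfolding \<open>m = Suc m'\<close> shift by simp
    then show ?case using Cons \<open>m = Suc m'\<close> by simp
  qed
  with comp show ?thesis by (simp add: length_le_encode)
qed

lemma computable_rev:
  assumes "computable l"
  shows "computable (\<lambda>x. rev (l x))"
proof -
  have "computable (\<lambda>x. foldl (\<lambda>ys y. y # ys) [] (l x))"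
    by (intro computable_foldl computable_intros assms)
  moreover have "foldl (\<lambda>ys y. y # ys) zs xs = rev xs @ zs" for xs zs :: "'b list"
    by (induction xs arbitrary: zs) auto
  ultimately show ?thesis by simp
qed

lemma computable_foldr:
  assumes "computable l" and "computable f"
    and "computable (\<lambda>p. g (fst p) (fst (snd p)) (snd (snd p)))"
  shows "computable (\<lambda>x. foldr (g x) (l x) (f x))"
proof -
  have "computable (\<lambda>x. foldl (\<lambda>a y. g x y a) (f x) (rev (l x)))"
    using computable_comp[OF assms(3), of "\<lambda>p. (fst p, snd (snd p), fst (snd p))"]
    by (intro computable_foldl computable_rev assms) (simp add: computable_intros)
  then show ?thesis by (simp add: foldr_conv_foldl)
qed

lemma computable_append [computable_intros]:
  assumes "computable f" and "computable g"
  shows "computable (\<lambda>x. f x @ g x)"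
proof -
  have "computable (\<lambda>x. foldr (\<lambda>y ys. y # ys) (f x) (g x))"
    by (intro computable_foldr computable_intros assms)
  moreover have "foldr (\<lambda>y ys. y # ys) xs ys = xs @ ys" for xs ys :: "'b list"
    by (induction xs) auto
  ultimately show ?thesis by simp
qed

lemma computable_length [computable_intros]:
  assumes "computable f"
  shows "computable (\<lambda>x. length (f x))"
proof -
  have "computable (\<lambda>x. foldr (\<lambda>_ n. Suc n) (f x) 0)"
    by (intro computable_foldr computable_intros assms)
  moreover have "foldr (\<lambda>_ n. Suc n) xs 0 = length xs" for xs :: "'b list"
    by (induction xs) auto
  ultimately show ?thesis by simp
qed

lemma computable_concat [computable_intros]:
  assumes "computable f"
  shows "computable (\<lambda>x. concat (f x))"
  unfolding concat_conv_foldr by (intro computable_foldr computable_intros assms)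

lemma computable_map [computable_intros]:
  assumes "computable f" and "computable (\<lambda>p. g (fst p) (snd p))"
  shows "computable (\<lambda>x. map (g x) (f x))"
proof -
  have "computable (\<lambda>x. foldr (\<lambda>y ys. g x y # ys) (f x) [])"
    using computable_comp[OF assms(2), of "\<lambda>p. (fst p, fst (snd p))"]
    by (intro computable_foldr computable_intros assms) (simp add: computable_intros)
  moreover have "foldr (\<lambda>y ys. g x y # ys) xs [] = map (g x) xs" for x xs
    by (induction xs) auto
  ultimately show ?thesis by simp
qed

lemma computable_filter [computable_intros]:
  assumes "computable f" and "decidable (\<lambda>p. P (fst p) (snd p))"
  shows "computable (\<lambda>x. filter (P x) (f x))"
proof -
  have "decidable (\<lambda>p. P (fst p) (fst (snd p)))"
    using computable_comp[OF assms(2)[unfolded decidable_def], of "\<lambda>p. (fst p, fst (snd p))"]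
    by (simp add: computable_intros decidable_def)
  then have "computable (\<lambda>x. foldr (\<lambda>y ys. if P x y then y # ys else ys) (f x) [])"
    by (intro computable_foldr computable_intros assms)
  moreover have "foldr (\<lambda>y ys. if P x y then y # ys else ys) xs [] = filter (P x) xs" for x xs
    by (induction xs) auto
  ultimately show ?thesis by simp
qed

lemma computable_upt [computable_intros]:
  assumes "computable n"
  shows "computable (\<lambda>x. [0..<n x])"
proof -
  have "computable (\<lambda>x. rec_nat [] (\<lambda>m r. r @ [m]) (n x))"
    by (intro computable_intros assms)
  moreover have "rec_nat [] (\<lambda>m r. r @ [m]) m = [0..<m]" for m
    by (induction m) auto
  ultimately show ?thesis by simp
qed

lemma computable_n_lists [computable_intros]:
  assumes "computable n" and "computable f"
  shows "computable (\<lambda>x. List.n_lists (n x) (f x))"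
proof -
  have "computable (\<lambda>x. rec_nat [[]] (\<lambda>_ r. concat (map (\<lambda>ys. map (\<lambda>y. y # ys) (f x)) r)) (n x))"
    by (intro computable_intros assms computable_comp[OF assms(2)])
  moreover have "rec_nat [[]] (\<lambda>_ r. concat (map (\<lambda>ys. map (\<lambda>y. y # ys) xs) r)) m
      = List.n_lists m xs" for xs :: "'b list" and m
    by (induction m) auto
  ultimately show ?thesis by simp
qed

text \<open>Lookup with a default: the value of \<open>!\<close> beyond the end of a list is
  unspecified and cannot be computed.\<close>

definition entry :: "'a \<Rightarrow> 'a list \<Rightarrow> nat \<Rightarrow> 'a" where
  "entry z xs i = (if i < length xs then xs ! i else z)"

lemma computable_entry [computable_intros]:
  assumes "computable l" and "computable i"
  shows "computable (\<lambda>x. entry z (l x) (i x))"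
proof -
  have "computable (\<lambda>x. case rec_nat (l x) (\<lambda>_ r. tl r) (i x) of [] \<Rightarrow> z | y # ys \<Rightarrow> y)"
    by (intro computable_case_list computable_tl computable_intros assms)
  moreover have "rec_nat xs (\<lambda>_ r. tl r) m = drop m xs" for m and xs :: "'b list"
    by (induction m) (auto simp: drop_Suc tl_drop)
  moreover have "(case drop m xs of [] \<Rightarrow> z | y # ys \<Rightarrow> y) = entry z xs m" for m xs
    by (auto simp: entry_def Cons_nth_drop_Suc[symmetric])
  ultimately show ?thesis by simp
qed

section \<open>Integers\<close>

text \<open>Nonnegative \<open>i\<close> have the even code \<open>2 i\<close>, negative ones the
  odd code \<open>2 (- i - 1) + 1\<close>, so both parts of an integer can be read off by parity and
  halving.\<close>

lemma nat_half_int_encode: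
  "(if even (encode i) then encode i div 2 else 0) = nat i"
  "(if even (encode i) then 0 else Suc (encode i div 2)) = nat (- i)"
  by (auto simp: encode_int_def int_encode_def sum_encode_def)

lemma computable_nat [computable_intros]:
  assumes "computable f"
  shows "computable (\<lambda>x. nat (f x))"
proof -
  have "computable (\<lambda>x. if even (encode (f x)) then encode (f x) div 2 else 0)"
    by (intro computable_intros computable_half computable_encode assms)
  then show ?thesis unfolding nat_half_int_encode .
qed

lemma computable_nat_uminus [computable_intros]:
  assumes "computable f"
  shows "computable (\<lambda>x. nat (- f x))"
proof -
  have "computable (\<lambda>x. if even (encode (f x)) then 0 else Suc (encode (f x) div 2))"
    by (intro computable_intros computable_half computable_encode assms)
  then show ?thesis unfolding nat_half_int_encode .
qed

text \<open>The way back from naturals to integers: the operations below compute with positive and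
  negative parts and subtract at the end.\<close>

lemma computable_int_diff:
  assumes "computable f" and "computable g"
  shows "computable (\<lambda>x. int (f x) - int (g x))"
proof -
  have "computable (\<lambda>x. decode (if g x \<le> f x then 2 * (f x - g x) else Suc (2 * (g x - f x - 1))) :: int)"
    by (intro computable_decode computable_intros assms)
  moreover have "(if n \<le> m then 2 * (m - n) else Suc (2 * (n - m - 1))) = encode (int m - int n)"
    for m n
    by (auto simp: encode_int_def int_encode_def sum_encode_def nat_diff_distrib)
  ultimately show ?thesis by simp
qed

lemma computable_int [computable_intros]:
  assumes "computable f"
  shows "computable (\<lambda>x. int (f x))"
  using computable_int_diff[OF assms computable_const[of "0 :: nat"]] by simp

lemma computable_plus_int [computable_intros]:
  fixes f g :: "'a::encodable \<Rightarrow> int"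
  assumes "computable f" and "computable g"
  shows "computable (\<lambda>x. f x + g x)"
proof -
  have "computable (\<lambda>x. int (nat (f x) + nat (g x)) - int (nat (- f x) + nat (- g x)))"
    by (intro computable_int_diff computable_intros assms)
  moreover have "int (nat i + nat j) - int (nat (- i) + nat (- j)) = i + j" for i j
    by auto
  ultimately show ?thesis by simp
qed

lemma computable_times_int [computable_intros]:
  fixes f g :: "'a::encodable \<Rightarrow> int"
  assumes "computable f" and "computable g"
  shows "computable (\<lambda>x. f x * g x)"
proof -
  have "computable (\<lambda>x. int (nat (f x) * nat (g x) + nat (- f x) * nat (- g x))
      - int (nat (f x) * nat (- g x) + nat (- f x) * nat (g x)))"
    by (intro computable_int_diff computable_intros assms)
  moreover have "int (nat i * nat j + nat (- i) * nat (- j))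
      - int (nat i * nat (- j) + nat (- i) * nat j) = i * j" for i j
  proof -
    have "i = int (nat i) - int (nat (- i))" "j = int (nat j) - int (nat (- j))" by auto
    then have "i * j = (int (nat i) - int (nat (- i))) * (int (nat j) - int (nat (- j)))" by simp
    then show ?thesis by (simp add: algebra_simps)
  qed
  ultimately show ?thesis by simp
qed

lemma computable_abs_int [computable_intros]:
  fixes f :: "'a::encodable \<Rightarrow> int"
  assumes "computable f"
  shows "computable (\<lambda>x. \<bar>f x\<bar>)"
proof -
  have "computable (\<lambda>x. int (nat (f x) + nat (- f x)))"
    by (intro computable_intros assms)
  moreover have "int (nat i + nat (- i)) = \<bar>i\<bar>" for i
    by auto
  ultimately show ?thesis by simp
qed

lemma computable_sum_int [computable_intros]:
  fixes f :: "'a::encodable \<Rightarrow> nat \<Rightarrow> int"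
  assumes "computable n" and "computable (\<lambda>p. f (fst p) (snd p))"
  shows "computable (\<lambda>x. \<Sum>i < n x. f x i)"
proof -
  have "computable (\<lambda>x. rec_nat 0 (\<lambda>i r. r + f x i) (n x))"
    using computable_comp[OF assms(2), of "\<lambda>p. (fst p, fst (snd p))"]
    by (intro computable_intros assms) (simp add: computable_intros)
  moreover have "rec_nat 0 (\<lambda>i r. r + f x i) m = (\<Sum>i<m. f x i)" for x m
    by (induction m) auto
  ultimately show ?thesis by simp
qed

lemma computable_div_nat [computable_intros]:
  fixes f g :: "'a::encodable \<Rightarrow> nat"
  assumes "computable f" and "computable g"
  shows "computable (\<lambda>x. f x div g x)"
proof -
  \<comment> \<open>The quotient is the number of \<open>q\<close> whose successor still satisfies
    \<open>n * Suc q \<le> m\<close>; all of them are below \<open>m\<close>. The value at divisor 0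
    is that of \<open>div\<close>.\<close>
  have "computable (\<lambda>x. if g x = 0 then 0 else length (filter (\<lambda>q. g x * Suc q \<le> f x) [0..<f x]))"
    by (intro computable_intros assms assms[THEN computable_comp])
  moreover have "(if n = 0 then 0 else length (filter (\<lambda>q. n * Suc q \<le> m) [0..<m])) = m div n"
    for m n :: nat
  proof (cases "n = 0")
    case False
    have "q < m div n \<longleftrightarrow> q < m \<and> n * Suc q \<le> m" for q
    proof -
      have "q < m div n \<longleftrightarrow> n * Suc q \<le> m"
        using False by (simp add: Suc_le_eq[symmetric] less_eq_div_iff_mult_less_eq mult.commute)
      moreover have "q < m" if "q < m div n"
        using that div_le_dividend[of m n] by linarith
      ultimately show ?thesis by blast
    qed
    then have "{q. q < m \<and> n * Suc q \<le> m} = {..<m div n}" by auto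
    moreover have "length (filter (\<lambda>q. n * Suc q \<le> m) [0..<m]) = card {q. q < m \<and> n * Suc q \<le> m}"
      by (simp add: length_filter_conv_card cong: conj_cong)
    ultimately show ?thesis using False by simp
  qed simp
  ultimately show ?thesis by simp
qed

text \<open>Rounds towards zero, unlike \<open>div\<close>. It serves to test divisibility and to
  divide multiples, where the two agree.\<close>

definition quot :: "int \<Rightarrow> nat \<Rightarrow> int" where
  "quot i m = int (nat i div m) - int (nat (- i) div m)"

lemma computable_quot [computable_intros]:
  assumes "computable f" and "computable g"
  shows "computable (\<lambda>x. quot (f x) (g x))"
  unfolding quot_def by (intro computable_int_diff computable_intros assms)

lemma quot_mult: "m > 0 \<Longrightarrow> quot (int m * i) m = i"
  by (cases "i \<ge> 0") (auto simp: quot_def nat_mult_distrib nat_mult_distrib_neg mult_le_0_iff zero_le_mult_iff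
     simp flip: mult_minus_right)

section \<open>Decomposing solutions of linear equations into small ones\<close>

lemma sum_mset_nonneg:
  fixes w :: "'a \<Rightarrow> int"
  assumes "\<And>q. q \<in># Q \<Longrightarrow> 0 \<le> w q"
  shows "0 \<le> (\<Sum>q\<in>#Q. w q)"
  using assms by (induction Q) auto

lemma sum_mset_nonpos:
  fixes w :: "'a \<Rightarrow> int"
  assumes "\<And>q. q \<in># Q \<Longrightarrow> w q \<le> 0"
  shows "(\<Sum>q\<in>#Q. w q) \<le> 0"
  using assms by (induction Q) (auto intro: add_nonpos_nonpos)

text \<open>Greedy ordering: the elements not yet chosen sum to minus the current partial sum
  \<open>s\<close>, so one of them has a sign that pulls \<open>s\<close> back towards zero, and the
  next partial sum stays in \<open>[- c, c]\<close>.\<close>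

lemma balanced_prefix:
  fixes w :: "'a \<Rightarrow> int" and c :: int
  assumes "\<And>q. q \<in># Q \<Longrightarrow> \<bar>w q\<bar> \<le> c" and "(\<Sum>q\<in>#Q. w q) = 0" and "0 \<le> c" and "t \<le> size Q"
  shows "\<exists>xs. mset xs \<subseteq># Q \<and> length xs = t \<and> (\<forall>j\<le>t. \<bar>sum_list (map w (take j xs))\<bar> \<le> c)"
  using assms(4)
proof (induction t)
  case 0
  then show ?case using \<open>0 \<le> c\<close> by (intro exI[of _ "[]"]) auto
next
  case (Suc t)
  then obtain xs where xs: "mset xs \<subseteq># Q" "length xs = t"
    and bnd: "\<And>j. j \<le> t \<Longrightarrow> \<bar>sum_list (map w (take j xs))\<bar> \<le> c"
    by auto
  define s where "s = sum_list (map w xs)"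
  have s: "\<bar>s\<bar> \<le> c" using bnd[of t] xs(2) by (simp add: s_def)
  define R where "R = Q - mset xs"
  have Q: "Q = mset xs + R" using xs(1) by (simp add: R_def)
  have "size R = size Q - t" using Q xs(2) by simp
  with Suc.prems have "R \<noteq> {#}" by auto
  have sumR: "(\<Sum>q\<in>#R. w q) = - s"
    using assms(2) unfolding Q s_def by (simp flip: sum_mset_sum_list)
  have "\<exists>q\<in>#R. \<bar>s + w q\<bar> \<le> c"
  proof (cases "s > 0")
    case True
    have "\<exists>q\<in>#R. w q < 0"
    proof (rule ccontr)
      assume "\<not> ?thesis"
      then have "0 \<le> (\<Sum>q\<in>#R. w q)" by (intro sum_mset_nonneg) auto
      with sumR True show False by simp
    qed
    then obtain q where "q \<in># R" "w q < 0" by blast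
    moreover have "\<bar>w q\<bar> \<le> c" using assms(1)[of q] \<open>q \<in># R\<close> Q by auto
    ultimately show ?thesis using True s by (intro bexI[of _ q]) auto
  next
    \<comment> \<open>Here the rest sums to \<open>- s \<ge> 0\<close> and is nonempty, so its
      weights cannot all be negative.\<close>
    case False
    have "\<exists>q\<in>#R. w q \<ge> 0"
    proof (rule ccontr)
      assume "\<not> ?thesis"
      then have neg: "\<And>q. q \<in># R \<Longrightarrow> w q < 0" by force
      obtain q R' where R': "R = add_mset q R'" using \<open>R \<noteq> {#}\<close> by (meson multiset_cases)
      have "(\<Sum>q\<in>#R'. w q) \<le> 0"
        using neg R' by (intro sum_mset_nonpos) (auto intro: less_imp_le)
      with neg[of q] sumR False R' show False by simp
    qed
    then obtain q where "q \<in># R" "w q \<ge> 0" by blast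
    moreover have "\<bar>w q\<bar> \<le> c" using assms(1)[of q] \<open>q \<in># R\<close> Q by auto
    ultimately show ?thesis using False s by (intro bexI[of _ q]) auto
  qed
  then obtain q where q: "q \<in># R" "\<bar>s + w q\<bar> \<le> c" by blast
  have "mset (xs @ [q]) \<subseteq># Q" using q(1) unfolding Q by simp
  moreover have "\<bar>sum_list (map w (take j (xs @ [q])))\<bar> \<le> c" if "j \<le> Suc t" for j
  proof (cases "j = Suc t")
    case True
    then show ?thesis using q(2) xs(2) by (simp add: s_def)
  next
    case False
    then show ?thesis using bnd[of j] that xs(2) by simp
  qed
  ultimately show ?case using xs(2) by (intro exI[of _ "xs @ [q]"]) auto
qed

text \<open>A balanced sequence of length \<open>2 c + 1\<close> has \<open>2 c + 2\<close> prefix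
  sums, but only \<open>2 c + 1\<close> integers lie in \<open>[- c, c]\<close>. Two prefix sums
  agree, and the segment between them sums to zero.\<close>

lemma small_zero_sum_part:
  fixes w :: "'a \<Rightarrow> int" and c :: nat
  assumes "\<And>q. q \<in># Q \<Longrightarrow> \<bar>w q\<bar> \<le> int c" and "(\<Sum>q\<in>#Q. w q) = 0" and "Q \<noteq> {#}"
  shows "\<exists>Z. Z \<subseteq># Q \<and> Z \<noteq> {#} \<and> (\<Sum>q\<in>#Z. w q) = 0 \<and> size Z \<le> 2 * c + 1"
proof (cases "size Q \<le> 2 * c + 1")
  case True
  then show ?thesis using assms by blast
next
  case False
  then obtain xs where xs: "mset xs \<subseteq># Q" "length xs = 2 * c + 1"
    and bnd: "\<And>j. j \<le> 2 * c + 1 \<Longrightarrow> \<bar>sum_list (map w (take j xs))\<bar> \<le> int c"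
    using balanced_prefix[OF assms(1,2), where t = "2 * c + 1"] by auto
  let ?s = "\<lambda>j. sum_list (map w (take j xs))"
  have "?s ` {..2 * c + 1} \<subseteq> {- int c..int c}"
    using bnd by (force simp: abs_le_iff)
  then have "card (?s ` {..2 * c + 1}) \<le> card {- int c..int c}"
    by (intro card_mono) auto
  also have "\<dots> < card {..2 * c + 1}" by simp
  finally have "\<not> inj_on ?s {..2 * c + 1}" by (rule pigeonhole)
  then obtain i j where ij: "i < j" "j \<le> 2 * c + 1" "?s i = ?s j"
    unfolding inj_on_def by (metis atMost_iff linorder_neqE_nat)
  define zs where "zs = drop i (take j xs)"
  have split: "take j xs = take i xs @ zs"
    unfolding zs_def using ij(1) by (metis append_take_drop_id min.absorb1 nless_le take_take)
  have "mset zs \<subseteq># mset xs"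
    by (metis append_take_drop_id mset_append mset_subset_eq_add_left mset_subset_eq_add_right
        split subset_mset.order_trans)
  moreover have "(\<Sum>q\<in>#mset zs. w q) = 0"
    using ij(3) split by (simp flip: sum_mset_sum_list)
  moreover have "length zs = j - i" using ij xs(2) by (simp add: zs_def)
  ultimately show ?thesis
    using ij xs(1) by (intro exI[of _ "mset zs"]) (auto intro: subset_mset.order_trans)
qed

lemma zero_sum_decomposition:
  fixes w :: "'a \<Rightarrow> int" and c :: nat
  assumes "\<And>q. q \<in># Q \<Longrightarrow> \<bar>w q\<bar> \<le> int c" and "(\<Sum>q\<in>#Q. w q) = 0"
  shows "\<exists>P. sum_mset P = Q \<and> (\<forall>Z\<in>#P. (\<Sum>q\<in>#Z. w q) = 0 \<and> size Z \<le> 2 * c + 1)"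
  using assms
proof (induction "size Q" arbitrary: Q rule: less_induct)
  case less
  show ?case
  proof (cases "Q = {#}")
    case True
    then show ?thesis by (intro exI[of _ "{#}"]) auto
  next
    case False
    then obtain Z where Z: "Z \<subseteq># Q" "Z \<noteq> {#}" "(\<Sum>q\<in>#Z. w q) = 0" "size Z \<le> 2 * c + 1"
      using small_zero_sum_part[OF less.prems] by blast
    define R where "R = Q - Z"
    have Q: "Q = Z + R" using Z(1) by (simp add: R_def)
    have "size R < size Q" using Q Z(2) by (simp add: nonempty_has_size)
    moreover have "(\<Sum>q\<in>#R. w q) = 0" using less.prems(2) Z(3) unfolding Q by simp
    moreover have "\<bar>w q\<bar> \<le> int c" if "q \<in># R" for q using less.prems(1) that Q by simp
    ultimately obtain P where "sum_mset P = R"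
      "\<forall>Z\<in>#P. (\<Sum>q\<in>#Z. w q) = 0 \<and> size Z \<le> 2 * c + 1"
      using less.hyps by blast
    then show ?thesis using Z Q by (intro exI[of _ "add_mset Z P"]) auto
  qed
qed

text \<open>A multiset of variables is a vector of natural numbers, and its size is the 1-norm. Imposing
  one more equation on vectors of norm at most \<open>b\<close> multiplies the norm of the pieces by at
  most \<open>2 c b + 1\<close>.\<close>

definition piece_bound :: "nat \<Rightarrow> nat \<Rightarrow> nat" where
  "piece_bound c r = rec_nat 1 (\<lambda>_ b. b * (2 * (c * b) + 1)) r"

lemma sum_mset_sum_mset:
  "(\<Sum>p\<in>#P. \<Sum>v\<in>#p. \<phi> v) = (\<Sum>v\<in>#sum_mset P. \<phi> v :: 'b::comm_monoid_add)"
  by (induction P) auto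

lemma size_sum_mset: "size (sum_mset (P :: 'a multiset multiset)) = (\<Sum>p\<in>#P. size p)"
  by (induction P) auto

lemma abs_sum_mset_le:
  fixes \<phi> :: "'a \<Rightarrow> int"
  assumes "\<And>v. v \<in># p \<Longrightarrow> \<bar>\<phi> v\<bar> \<le> c"
  shows "\<bar>\<Sum>v\<in>#p. \<phi> v\<bar> \<le> c * int (size p)"
  using assms
proof (induction p)
  case (add v p)
  have "\<bar>\<phi> v + (\<Sum>v\<in>#p. \<phi> v)\<bar> \<le> \<bar>\<phi> v\<bar> + \<bar>\<Sum>v\<in>#p. \<phi> v\<bar>" by (rule abs_triangle_ineq)
  also have "\<dots> \<le> c + c * int (size p)" using add by (intro add_mono) auto
  finally show ?case by (simp add: algebra_simps)
qed simp

text \<open>Induction on the equations: the pieces solving the earlier ones become elements of a new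
  multiset, weighted by their value in the next equation. Splitting that multiset into short
  zero-sum groups and merging each group gives the new pieces.\<close>

lemma solution_decomposition:
  fixes c :: nat and \<phi>s :: "('a \<Rightarrow> int) list"
  assumes "\<And>\<phi> v. \<phi> \<in> set \<phi>s \<Longrightarrow> v \<in># m \<Longrightarrow> \<bar>\<phi> v\<bar> \<le> int c"
    and "\<And>\<phi>. \<phi> \<in> set \<phi>s \<Longrightarrow> (\<Sum>v\<in>#m. \<phi> v) = 0"
  shows "\<exists>P. sum_mset P = m
    \<and> (\<forall>p\<in>#P. size p \<le> piece_bound c (length \<phi>s) \<and> (\<forall>\<phi>\<in>set \<phi>s. (\<Sum>v\<in>#p. \<phi> v) = 0))"
  using assms
proof (induction \<phi>s)
  case Nil
  \<comment> \<open>Without equations the single variables are the pieces, whence the initial bound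
    1.\<close>
  have "sum_mset (image_mset (\<lambda>v. {#v#}) m) = m" by (induction m) auto
  then show ?case by (intro exI[of _ "image_mset (\<lambda>v. {#v#}) m"]) (auto simp: piece_bound_def)
next
  case (Cons \<phi> \<phi>s)
  define b where "b = piece_bound c (length \<phi>s)"
  obtain P where P: "sum_mset P = m"
    and small: "\<And>p. p \<in># P \<Longrightarrow> size p \<le> b"
    and zero: "\<And>p \<psi>. p \<in># P \<Longrightarrow> \<psi> \<in> set \<phi>s \<Longrightarrow> (\<Sum>v\<in>#p. \<psi> v) = 0"
    using Cons unfolding b_def by (metis list.set_intros(2))
  define w where "w p = (\<Sum>v\<in>#p. \<phi> v)" for p
  have "\<bar>w p\<bar> \<le> int (c * b)" if p: "p \<in># P" for p
  proof -
    have "\<bar>\<phi> v\<bar> \<le> int c" if "v \<in># p" for v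
      using Cons.prems(1)[of \<phi> v] p that P by (auto dest!: multi_member_split)
    then have "\<bar>w p\<bar> \<le> int c * int (size p)" unfolding w_def by (rule abs_sum_mset_le)
    also have "\<dots> \<le> int c * int b" using small[OF p] by (intro mult_left_mono) auto
    finally show ?thesis by simp
  qed
  moreover have "(\<Sum>p\<in>#P. w p) = 0"
    unfolding w_def sum_mset_sum_mset P using Cons.prems(2) by simp
  ultimately obtain PP where PP: "sum_mset PP = P"
    and Z: "\<And>Z. Z \<in># PP \<Longrightarrow> (\<Sum>p\<in>#Z. w p) = 0" "\<And>Z. Z \<in># PP \<Longrightarrow> size Z \<le> 2 * (c * b) + 1"
    using zero_sum_decomposition[of P w "c * b"] by blast
  have "size (sum_mset Z) \<le> piece_bound c (length (\<phi> # \<phi>s))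
      \<and> (\<forall>\<psi>\<in>set (\<phi> # \<phi>s). (\<Sum>v\<in>#sum_mset Z. \<psi> v) = 0)" if "Z \<in># PP" for Z
  proof -
    have sub: "p \<in># P" if "p \<in># Z" for p
      using that \<open>Z \<in># PP\<close> PP by (auto dest!: multi_member_split)
    have "size (sum_mset Z) = (\<Sum>p\<in>#Z. size p)" by (rule size_sum_mset)
    also have "\<dots> \<le> (\<Sum>p\<in>#Z. b)" using small sub by (intro sum_mset_mono) auto
    also have "\<dots> = size Z * b" by simp
    also have "\<dots> \<le> (2 * (c * b) + 1) * b" using Z(2)[OF that] by (intro mult_right_mono) auto
    finally have "size (sum_mset Z) \<le> piece_bound c (length (\<phi> # \<phi>s))"
      by (simp add: b_def piece_bound_def algebra_simps)
    moreover have "(\<Sum>v\<in>#sum_mset Z. \<phi> v) = 0"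
      using Z(1)[OF that] unfolding w_def sum_mset_sum_mset .
    moreover have "(\<Sum>v\<in>#sum_mset Z. \<psi> v) = 0" if "\<psi> \<in> set \<phi>s" for \<psi>
      using zero[OF sub that] by (auto simp flip: sum_mset_sum_mset intro!: sum_mset.neutral)
    ultimately show ?thesis by simp
  qed
  moreover have "sum_mset (image_mset sum_mset PP) = m"
    using sum_mset_sum_mset[of "\<lambda>v. v" PP] PP P by simp
  ultimately show ?case by (intro exI[of _ "image_mset sum_mset PP"]) auto
qed

section \<open>Small witnesses for many solutions\<close>

text \<open>The system whose variables are \<open>Sol l j = y\<^sub>l\<^sub>j\<close>, \<open>Shift j = x\<^sub>j\<close>, the homogenizing variable
  \<open>One\<close>, and \<open>Slack l l'\<close>, which turns a strict inequality between chosen coordinates of \<open>y\<^sub>l\<close>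
  and \<open>y\<^sub>l'\<close> into an equation. The piece of a solution that contains \<open>One\<close> is again
  inhomogeneous and keeps the \<open>y\<^sub>l\<close> distinct.\<close>

datatype var = Sol nat nat | Shift nat | One | Slack nat nat

lemma sum_mset_of_bool: "(\<Sum>v\<in>#p. of_bool (v = u)) = int (count p u)"
  by (induction p) auto

lemma sum_mset_sum: "(\<Sum>v\<in>#p. \<Sum>j\<in>J. \<phi> j v) = (\<Sum>j\<in>J. \<Sum>v\<in>#p. \<phi> j v :: 'b::comm_monoid_add)"
  by (induction p) (auto simp: sum.distrib)

lemma sum_mset_diff: "(\<Sum>v\<in>#p. \<phi> v - \<psi> v) = (\<Sum>v\<in>#p. \<phi> v) - (\<Sum>v\<in>#p. \<psi> v :: int)"
  by (induction p) auto

lemma sum_mset_scale: "(\<Sum>v\<in>#p. c * \<phi> v) = c * (\<Sum>v\<in>#p. \<phi> v :: int)"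
  by (induction p) (auto simp: algebra_simps)

lemma small_witnesses:
  fixes a :: "nat \<Rightarrow> nat \<Rightarrow> int" and x :: "nat \<Rightarrow> nat" and y :: "nat \<Rightarrow> nat \<Rightarrow> nat"
  assumes a: "\<And>i j. i < d \<Longrightarrow> j < n \<Longrightarrow> \<bar>a i j\<bar> \<le> int c" and f: "\<And>i. i < d \<Longrightarrow> \<bar>f i\<bar> \<le> int c"
    and c: "c \<ge> 1"
    and sol: "\<And>l i. l < k \<Longrightarrow> i < d \<Longrightarrow>
      (\<Sum>j<n. a i j * int (y l j)) = f i + (\<Sum>j<n. a i j * int (x j))"
    and dist: "\<And>l l'. l < k \<Longrightarrow> l' < k \<Longrightarrow> l \<noteq> l' \<Longrightarrow> \<exists>j<n. y l j \<noteq> y l' j"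
  defines "B \<equiv> piece_bound c (k * d + k * k)"
  obtains x' y' where "\<And>j. j < n \<Longrightarrow> x' j \<le> x j" "\<And>j. j < n \<Longrightarrow> x' j \<le> B"
    "\<And>l j. l < k \<Longrightarrow> j < n \<Longrightarrow> y' l j \<le> B"
    "\<And>l i. l < k \<Longrightarrow> i < d \<Longrightarrow>
      (\<Sum>j<n. a i j * int (y' l j)) = f i + (\<Sum>j<n. a i j * int (x' j))"
    "\<And>l l'. l < k \<Longrightarrow> l' < k \<Longrightarrow> l \<noteq> l' \<Longrightarrow> \<exists>j<n. y' l j \<noteq> y' l' j"
proof -
  define above where "above l l' \<longleftrightarrow> (\<exists>j<n. y l' j < y l j)" for l l'
  \<comment> \<open>Fixing a coordinate that separates the given solutions turns distinctness into
    one linear inequality per ordered pair.\<close>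
  define J where "J l l' = (SOME j. j < n \<and> y l' j < y l j)" for l l'
  have J: "J l l' < n" "y l' (J l l') < y l (J l l')" if "above l l'" for l l'
    using someI_ex[of "\<lambda>j. j < n \<and> y l' j < y l j"] that unfolding above_def J_def by auto
  \<comment> \<open>Row \<open>i\<close> of \<open>A y_l - A x - f = 0\<close>, where
    \<open>f\<close> is multiplied by \<open>One\<close>.\<close>
  define E where "E = (\<lambda>(l, i) v. (\<Sum>j<n. a i j * of_bool (v = Sol l j))
    - (\<Sum>j<n. a i j * of_bool (v = Shift j)) - f i * of_bool (v = One))"
  \<comment> \<open>The equation \<open>y_l - y_l' = One + Slack\<close> at the chosen coordinate.
    Pairs without such a coordinate get the zero equation, so the number of equations does not
    depend on the solutions.\<close>
  define D where "D = (\<lambda>(l, l') v. if above l l' then of_bool (v = Sol l (J l l'))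
    - of_bool (v = Sol l' (J l l')) - of_bool (v = One) - of_bool (v = Slack l l') else (0::int))"
  have E: "(\<Sum>v\<in>#p. E (l, i) v) = (\<Sum>j<n. a i j * int (count p (Sol l j)))
      - (\<Sum>j<n. a i j * int (count p (Shift j))) - f i * int (count p One)" for p l i
    by (simp only: E_def case_prod_conv sum_mset_diff sum_mset_sum sum_mset_scale sum_mset_of_bool)
  have D: "(\<Sum>v\<in>#p. D (l, l') v) = int (count p (Sol l (J l l'))) - int (count p (Sol l' (J l l')))
      - int (count p One) - int (count p (Slack l l'))" if "above l l'" for p l l'
    using that by (simp only: D_def case_prod_conv if_True sum_mset_diff sum_mset_of_bool)
  \<comment> \<open>The given solution as multiplicities; its support is finite, so it is a
    multiset.\<close>
  define g where "g v = (case v of Sol l j \<Rightarrow> if l < k \<and> j < n then y l j else 0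
    | Shift j \<Rightarrow> if j < n then x j else 0 | One \<Rightarrow> 1
    | Slack l l' \<Rightarrow> if l < k \<and> l' < k \<and> above l l' then y l (J l l') - y l' (J l l') - 1 else 0)" for v
  define m where "m = Abs_multiset g"
  have "{v. 0 < g v} \<subseteq> case_prod Sol ` ({..<k} \<times> {..<n}) \<union> Shift ` {..<n} \<union> {One}
      \<union> case_prod Slack ` ({..<k} \<times> {..<k})"
  proof
    fix v assume "v \<in> {v. 0 < g v}"
    then show "v \<in> case_prod Sol ` ({..<k} \<times> {..<n}) \<union> Shift ` {..<n} \<union> {One}
        \<union> case_prod Slack ` ({..<k} \<times> {..<k})"
      by (cases v) (force simp: g_def image_iff split: if_splits)+
  qed
  then have "finite {v. 0 < g v}"
    by (rule finite_subset) auto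
  then have m: "count m v = g v" for v
    unfolding m_def by simp
  define \<phi>s where "\<phi>s = map E (List.product [0..<k] [0..<d]) @ map D (List.product [0..<k] [0..<k])"
  have len: "length \<phi>s = k * d + k * k" by (simp add: \<phi>s_def)
  have "\<bar>\<phi> v\<bar> \<le> int c" if "\<phi> \<in> set \<phi>s" for \<phi> v
  proof -
    have "\<bar>E (l, i) v\<bar> \<le> int c" if "i < d" for l i
    proof (cases v)
      case (Sol l' j)
      have "E (l, i) v = (\<Sum>j'<n. if j' = j then a i j' * of_bool (l' = l) else 0)"
        unfolding E_def Sol by (auto intro!: sum.cong)
      then show ?thesis using a[OF that] by simp
    next
      case (Shift j)
      have "E (l, i) v = - (\<Sum>j'<n. if j' = j then a i j' else 0)"
        unfolding E_def Shift by (auto intro!: sum.cong)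
      then show ?thesis using a[OF that] by simp
    qed (use f[OF that] in \<open>auto simp: E_def\<close>)
    moreover have "\<bar>D (l, l') v\<bar> \<le> int c" for l l'
      using c J(2)[of l l'] by (cases v) (auto simp: D_def)
    ultimately show ?thesis using that by (auto simp: \<phi>s_def)
  qed
  moreover have "(\<Sum>v\<in>#m. \<phi> v) = 0" if "\<phi> \<in> set \<phi>s" for \<phi>
  proof -
    have "(\<Sum>v\<in>#m. E (l, i) v) = 0" if "l < k" "i < d" for l i
      using sol[OF that] that by (simp add: E m g_def)
    moreover have "(\<Sum>v\<in>#m. D (l, l') v) = 0" if "l < k" "l' < k" for l l'
    proof (cases "above l l'")
      case True
      then show ?thesis using J[OF True] that by (simp add: D m g_def)
    qed (simp add: D_def)
    ultimately show ?thesis using that by (auto simp: \<phi>s_def)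
  qed
  ultimately obtain P where P: "sum_mset P = m"
    and small: "\<And>p. p \<in># P \<Longrightarrow> size p \<le> B"
    and zero: "\<And>p \<phi>. p \<in># P \<Longrightarrow> \<phi> \<in> set \<phi>s \<Longrightarrow> (\<Sum>v\<in>#p. \<phi> v) = 0"
    using solution_decomposition[of \<phi>s m c] unfolding len B_def by blast
  have "One \<in># sum_mset P"
    using m[of One] by (simp add: P g_def flip: count_greater_zero_iff)
  then obtain p where p: "p \<in># P" "One \<in># p"
    by (auto simp: in_Union_mset_iff)
  \<comment> \<open>As a part of \<open>m\<close> the piece lies below the given solution, which
    yields \<open>x' \<le> x\<close>; its size yields the bound \<open>B\<close>.\<close>
  have "p \<subseteq># m"
    using P p(1) by (auto dest!: multi_member_split)
  then have le: "count p v \<le> g v" for v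
    by (simp add: mset_subset_eq_count flip: m)
  have leB: "count p v \<le> B" for v
    using small[OF p(1)] count_le_size[of p v] by linarith
  have one: "count p One = 1"
    using le[of One] p(2) by (simp add: g_def le_eq_less_or_eq flip: count_greater_zero_iff)
  have sol': "(\<Sum>j<n. a i j * int (count p (Sol l j))) = f i + (\<Sum>j<n. a i j * int (count p (Shift j)))"
    if "l < k" "i < d" for l i
  proof -
    have "E (l, i) \<in> set \<phi>s" using that by (auto simp: \<phi>s_def)
    from zero[OF p(1) this] show ?thesis by (simp add: E one)
  qed
  \<comment> \<open>\<open>One\<close> counts 1 and \<open>Slack\<close> at least 0, so the strict
    inequality survives in the piece.\<close>
  have strict: "\<exists>j<n. count p (Sol l' j) < count p (Sol l j)" if "l < k" "l' < k" "above l l'" for l l'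
  proof -
    have "D (l, l') \<in> set \<phi>s" using that by (auto simp: \<phi>s_def)
    from zero[OF p(1) this] show ?thesis
      using J(1)[OF that(3)] by (intro exI[of _ "J l l'"]) (simp add: D[OF that(3)] one)
  qed
  show thesis
  proof (rule that[of "\<lambda>j. count p (Shift j)" "\<lambda>l j. count p (Sol l j)"])
    show "count p (Shift j) \<le> x j" if "j < n" for j
      using le[of "Shift j"] that by (simp add: g_def)
    show "\<exists>j<n. count p (Sol l j) \<noteq> count p (Sol l' j)" if "l < k" "l' < k" "l \<noteq> l'" for l l'
    proof -
      have "above l l' \<or> above l' l"
        using dist[OF that] unfolding above_def by (metis linorder_neqE_nat)
      then show ?thesis using strict that by (metis less_irrefl)
    qed
  qed (use leB sol' in auto)
qed

section \<open>The holes of a cone\<close>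

text \<open>If \<open>q \<mu>\<close> is within \<open>1 / c\<close> of an integer vector \<open>p\<close>, then the integer vector \<open>q A \<mu> - A p\<close> has
  entries of absolute value less than \<open>1\<close>, so that \<open>q A \<mu> = A p\<close>.\<close>

lemma cone_denominator:
  fixes a :: "nat \<Rightarrow> nat \<Rightarrow> int" and b :: "nat \<Rightarrow> int" and \<mu> :: "nat \<Rightarrow> real" and c :: nat
  assumes c: "\<And>i. i < d \<Longrightarrow> (\<Sum>j<n. \<bar>a i j\<bar>) < int c" "c > 0"
    and nonneg: "\<And>j. j < n \<Longrightarrow> 0 \<le> \<mu> j"
    and b: "\<And>i. i < d \<Longrightarrow> real_of_int (b i) = (\<Sum>j<n. real_of_int (a i j) * \<mu> j)"
  obtains p :: "nat \<Rightarrow> nat"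
  where "\<And>i. i < d \<Longrightarrow> int (fact (c ^ n)) * b i = (\<Sum>j<n. a i j * int (p j))"
proof -
  obtain q p where q: "0 < q" "q \<le> int (c ^ n)"
    and p: "\<And>j. j < n \<Longrightarrow> \<bar>of_int q * \<mu> j - of_int (p j)\<bar> < 1 / real c"
    using Dirichlet_approx_simult[OF c(2), where \<theta> = \<mu> and n = n] by metis
  have p_nonneg: "0 \<le> p j" if "j < n" for j
  proof -
    have "0 \<le> of_int q * \<mu> j" using q(1) nonneg[OF that] by simp
    moreover have "1 / real c \<le> 1" using c(2) by simp
    ultimately have "real_of_int (p j) > -1" using p[OF that] by linarith
    then show ?thesis by linarith
  qed
  have eq: "q * b i = (\<Sum>j<n. a i j * p j)" if i: "i < d" for i
  proof -
    have "real_of_int (q * b i - (\<Sum>j<n. a i j * p j))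
        = (\<Sum>j<n. real_of_int (a i j) * (of_int q * \<mu> j - of_int (p j)))"
      by (simp add: b[OF i] sum_distrib_left sum_subtractf right_diff_distrib mult.left_commute)
    also have "\<bar>\<dots>\<bar> \<le> (\<Sum>j<n. \<bar>real_of_int (a i j) * (of_int q * \<mu> j - of_int (p j))\<bar>)"
      by (rule sum_abs)
    also have "\<dots> \<le> (\<Sum>j<n. \<bar>real_of_int (a i j)\<bar> * (1 / real c))"
      unfolding abs_mult using p by (intro sum_mono mult_left_mono) (auto intro: less_imp_le)
    also have "\<dots> = real_of_int (\<Sum>j<n. \<bar>a i j\<bar>) / real c"
      by (simp add: sum_divide_distrib)
    also have "\<dots> < 1"
      using c(2) c(1)[OF i] by (simp add: of_int_less_iff[where 'a = real, symmetric] del: of_int_less_iff)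
    finally have "\<bar>real_of_int (q * b i - (\<Sum>j<n. a i j * p j))\<bar> < 1" .
    then have "\<bar>q * b i - (\<Sum>j<n. a i j * p j)\<bar> < 1" by linarith
    then show ?thesis by linarith
  qed
  \<comment> \<open>Dirichlet's \<open>q\<close> depends on \<open>\<mu>\<close>, but being at most
    \<open>c ^ n\<close> it divides the factorial, which thus serves all points at once.\<close>
  have "nat q \<le> c ^ n" using q(2) by (simp only: nat_le_iff)
  then have "nat q dvd fact (c ^ n)" using q(1) by (intro dvd_fact) auto
  then obtain s where "fact (c ^ n) = nat q * s" ..
  then have s: "int (fact (c ^ n)) = int s * q" using q(1) by (metis int_nat_eq less_imp_le mult.commute of_nat_mult)
  have "int (fact (c ^ n)) * b i = (\<Sum>j<n. a i j * int (s * nat (p j)))" if "i < d" for i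
  proof -
    have "int (fact (c ^ n)) * b i = int s * (\<Sum>j<n. a i j * p j)"
      using eq[OF that] unfolding s by simp
    also have "\<dots> = (\<Sum>j<n. a i j * int (s * nat (p j)))"
      unfolding sum_distrib_left using p_nonneg by (intro sum.cong) (auto simp: mult_ac)
    finally show ?thesis .
  qed
  then show thesis by (rule that)
qed

text \<open>A point is a function of which only the values below \<open>d\<close> matter. The strict
  row bound \<open>c\<close> sets the precision in Dirichlet's theorem and also bounds the
  coefficients of the linear systems; \<open>T\<close> is the common denominator and
  \<open>B\<close> the size of the box.\<close>

locale hole_problem =
  fixes a :: "nat \<Rightarrow> nat \<Rightarrow> int" and d n k c T B :: nat
  assumes row_sum: "i < d \<Longrightarrow> (\<Sum>j<n. \<bar>a i j\<bar>) < int c"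
    and c_pos: "c > 0"
    and T_def: "T = fact (c ^ n)"
    and B_def: "B = piece_bound c (k * d + k * k)"
begin

definition app :: "nat list \<Rightarrow> nat \<Rightarrow> int" where
  "app w i = (\<Sum>j<n. a i j * int (w ! j))"

definition sols :: "(nat \<Rightarrow> int) \<Rightarrow> nat list set" where
  "sols b = {y. length y = n \<and> (\<forall>i<d. app y i = b i)}"

definition few :: "(nat \<Rightarrow> int) \<Rightarrow> bool" where
  "few b \<longleftrightarrow> finite (sols b) \<and> card (sols b) < k"

definition vplus :: "nat list \<Rightarrow> nat list \<Rightarrow> nat list" where
  "vplus v w = map (\<lambda>j. v ! j + w ! j) [0..<n]"

lemma length_vplus [simp]: "length (vplus v w) = n"
  by (simp add: vplus_def)

lemma nth_vplus [simp]: "j < n \<Longrightarrow> vplus v w ! j = v ! j + w ! j"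
  by (simp add: vplus_def)

lemma app_vplus: "app (vplus v w) i = app v i + app w i"
  by (simp add: app_def algebra_simps sum.distrib)

lemma inj_on_vplus: "inj_on (\<lambda>y. vplus y z) {y. length y = n}"
proof (rule inj_onI, rule nth_equalityI)
  fix v w j assume "v \<in> {y. length y = n}" "w \<in> {y. length y = n}" "vplus v z = vplus w z"
    "j < length v"
  then show "v ! j = w ! j" using nth_vplus[of j v z] nth_vplus[of j w z] by simp
qed auto

lemma T_pos: "T > 0"
  by (simp add: T_def)

lemma not_few_if_subset:
  assumes "Y \<subseteq> sols b" "card Y \<ge> k"
  shows "\<not> few b"
  using assms card_mono[of "sols b" Y] unfolding few_def by auto

lemma obtain_sols:
  assumes "\<not> few b"
  obtains Y where "Y \<subseteq> sols b" "card Y = k" "finite Y"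
proof (cases "finite (sols b)")
  case True
  then have "k \<le> card (sols b)" using assms by (simp add: few_def)
  then show ?thesis using obtain_subset_with_card_n that by metis
next
  case False
  then show ?thesis using infinite_arbitrarily_large that by metis
qed

text \<open>Adding \<open>z\<close> maps the preimages of \<open>b\<close> injectively to preimages
  of \<open>b + A z\<close>; hence having at least \<open>k\<close> preimages is an up-closed
  property.\<close>

lemma few_antimono:
  assumes few: "few (\<lambda>i. b i + app z i)"
  shows "few b"
proof (rule ccontr)
  assume "\<not> few b"
  then obtain Y where Y: "Y \<subseteq> sols b" "card Y = k"
    using obtain_sols by metis
  have "inj_on (\<lambda>y. vplus y z) Y"
    using inj_on_vplus by (rule inj_on_subset) (use Y in \<open>auto simp: sols_def\<close>)
  then have "card ((\<lambda>y. vplus y z) ` Y) = k" using Y by (simp add: card_image)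
  moreover have "(\<lambda>y. vplus y z) ` Y \<subseteq> sols (\<lambda>i. b i + app z i)"
    using Y(1) by (auto simp: sols_def app_vplus subset_eq)
  ultimately show False using not_few_if_subset few by blast
qed

text \<open>Applies \<open>small_witnesses\<close> to an enumeration of \<open>k\<close> preimages:
  the up-closed set is generated by points of the box, each with \<open>k\<close> preimages in the
  box.\<close>

lemma small_sols:
  assumes f: "\<And>i. i < d \<Longrightarrow> \<bar>f i\<bar> \<le> int c" and notfew: "\<not> few (\<lambda>i. f i + app z i)"
  obtains g Y where "length g = n" "\<And>j. j < n \<Longrightarrow> g ! j \<le> z ! j" "\<And>j. j < n \<Longrightarrow> g ! j \<le> B"
    "Y \<subseteq> sols (\<lambda>i. f i + app g i)" "card Y = k" "\<And>y j. y \<in> Y \<Longrightarrow> j < n \<Longrightarrow> y ! j \<le> B"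
proof -
  obtain Y where Y: "Y \<subseteq> sols (\<lambda>i. f i + app z i)" "card Y = k" "finite Y"
    using obtain_sols[OF notfew] by metis
  then obtain ys where ys: "bij_betw ys {..<k} Y"
    using ex_bij_betw_nat_finite[of Y] by (auto simp: atLeast0LessThan)
  have mem: "ys l \<in> Y" if "l < k" for l
    using ys that by (auto simp: bij_betw_def)
  have a: "\<bar>a i j\<bar> \<le> int c" if "i < d" "j < n" for i j
    using member_le_sum[of j "{..<n}" "\<lambda>j. \<bar>a i j\<bar>"] row_sum[OF that(1)] that by simp
  obtain x' y' where x': "\<And>j. j < n \<Longrightarrow> x' j \<le> z ! j" "\<And>j. j < n \<Longrightarrow> x' j \<le> B"
    and y': "\<And>l j. l < k \<Longrightarrow> j < n \<Longrightarrow> y' l j \<le> B"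
      "\<And>l i. l < k \<Longrightarrow> i < d \<Longrightarrow>
        (\<Sum>j<n. a i j * int (y' l j)) = f i + (\<Sum>j<n. a i j * int (x' j))"
      "\<And>l l'. l < k \<Longrightarrow> l' < k \<Longrightarrow> l \<noteq> l' \<Longrightarrow> \<exists>j<n. y' l j \<noteq> y' l' j"
  proof (rule small_witnesses[where a = a and d = d and n = n and c = c and f = f and k = k
        and y = "\<lambda>l j. ys l ! j" and x = "\<lambda>j. z ! j"])
    show "(\<Sum>j<n. a i j * int (ys l ! j)) = f i + (\<Sum>j<n. a i j * int (z ! j))"
      if "l < k" "i < d" for l i
      using mem[OF that(1)] Y(1) that(2) by (auto simp: sols_def app_def)
    show "\<exists>j<n. ys l ! j \<noteq> ys l' ! j" if "l < k" "l' < k" "l \<noteq> l'" for l l'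
    proof -
      have "ys l \<noteq> ys l'" using ys that by (auto simp: bij_betw_def inj_on_def)
      moreover have "length (ys l) = n" "length (ys l') = n"
        using mem that Y(1) by (auto simp: sols_def)
      ultimately show ?thesis by (metis nth_equalityI)
    qed
  qed (use a f c_pos in \<open>auto simp: B_def\<close>)
  define Y' where "Y' = (\<lambda>l. map (y' l) [0..<n]) ` {..<k}"
  have "inj_on (\<lambda>l. map (y' l) [0..<n]) {..<k}"
  proof (rule inj_onI, rule ccontr)
    fix l l' assume l: "l \<in> {..<k}" "l' \<in> {..<k}" and eq: "map (y' l) [0..<n] = map (y' l') [0..<n]"
      and "l \<noteq> l'"
    then show False using y'(3)[of l l'] by auto
  qed
  then have "card Y' = k" by (simp add: Y'_def card_image)
  moreover have "Y' \<subseteq> sols (\<lambda>i. f i + app (map x' [0..<n]) i)"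
    using y'(2) by (auto simp: Y'_def sols_def app_def)
  moreover have "y ! j \<le> B" if "y \<in> Y'" "j < n" for y j
    using that y'(1) by (auto simp: Y'_def)
  ultimately show thesis using x' by (intro that[of "map x' [0..<n]" Y']) auto
qed

text \<open>Otherwise some \<open>g \<le> x + z\<close> in the box has \<open>k\<close> preimages
  bounded by \<open>B\<close>. Where \<open>z\<close> is nonzero \<open>x\<close> already equals
  \<open>B\<close>, so \<open>g \<le> x\<close>; shifting the preimages by
  \<open>x - g \<le> B\<close> gives \<open>k\<close> preimages of \<open>f + A x\<close> bounded by
  \<open>2 B\<close>, contradicting the count.\<close>

lemma few_extend:
  assumes f: "\<And>i. i < d \<Longrightarrow> \<bar>f i\<bar> \<le> int c"
    and x: "\<And>j. j < n \<Longrightarrow> x ! j \<le> B"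
    and box: "card {y \<in> sols (\<lambda>i. f i + app x i). \<forall>j<n. y ! j \<le> 2 * B} < k"
    and z: "\<And>j. j < n \<Longrightarrow> z ! j \<noteq> 0 \<Longrightarrow> x ! j = B"
  shows "few (\<lambda>i. f i + app x i + app z i)"
proof (rule ccontr)
  assume "\<not> ?thesis"
  then have notfew: "\<not> few (\<lambda>i. f i + app (vplus x z) i)"
    by (simp add: app_vplus add.assoc)
  from f notfew show False
  proof (rule small_sols)
    fix g Y assume g: "length g = n" "\<And>j. j < n \<Longrightarrow> g ! j \<le> vplus x z ! j" "\<And>j. j < n \<Longrightarrow> g ! j \<le> B"
      and Y: "Y \<subseteq> sols (\<lambda>i. f i + app g i)" "card Y = k" "\<And>y j. y \<in> Y \<Longrightarrow> j < n \<Longrightarrow> y ! j \<le> B"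
    have le: "g ! j \<le> x ! j" if "j < n" for j
      using g(2,3)[OF that] z[OF that] that by (cases "z ! j = 0") auto
    define r where "r = map (\<lambda>j. x ! j - g ! j) [0..<n]"
    have app_r: "app g i + app r i = app x i" for i
      using le by (simp add: app_def r_def of_nat_diff algebra_simps flip: sum.distrib)
    let ?S = "{y \<in> sols (\<lambda>i. f i + app x i). \<forall>j<n. y ! j \<le> 2 * B}"
    have "inj_on (\<lambda>y. vplus y r) Y"
      using inj_on_vplus by (rule inj_on_subset) (use Y in \<open>auto simp: sols_def\<close>)
    then have "card ((\<lambda>y. vplus y r) ` Y) = k" using Y by (simp add: card_image)
    moreover have "(\<lambda>y. vplus y r) ` Y \<subseteq> ?S"
    proof
      fix v assume "v \<in> (\<lambda>y. vplus y r) ` Y"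
      then obtain y where y: "y \<in> Y" and v: "v = vplus y r" by blast
      have "v \<in> sols (\<lambda>i. f i + app x i)"
        using Y(1) y unfolding v by (auto simp: sols_def app_vplus simp flip: app_r)
      moreover have "v ! j \<le> 2 * B" if "j < n" for j
        using Y(3)[OF y that] x[OF that] that by (simp add: v r_def)
      ultimately show "v \<in> ?S" by blast
    qed
    moreover have "finite ?S"
      by (rule finite_subset[OF _ finite_lists_length_eq[of "{..2 * B}" n]])
         (auto simp: sols_def in_set_conv_nth)
    ultimately show False
      using box card_mono[of ?S "(\<lambda>y. vplus y r) ` Y"] by linarith
  qed
qed

definition in_cone :: "(nat \<Rightarrow> int) \<Rightarrow> bool" where
  "in_cone b \<longleftrightarrow> (\<exists>\<mu>. (\<forall>j<n. 0 \<le> \<mu> j) \<and>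
    (\<forall>i<d. real_of_int (b i) = (\<Sum>j<n. real_of_int (a i j) * \<mu> j)))"

text \<open>The list \<open>w = u + T x\<close> with \<open>u < T\<close> and \<open>x \<le> B\<close> codes both a lattice point \<open>A u / T\<close> of the
  half-open zonotope and a translation by \<open>A x\<close>; a coordinate \<open>x\<^sub>j = B\<close> is free to increase.\<close>

definition code :: "nat list \<Rightarrow> bool" where
  "code w \<longleftrightarrow> length w = n \<and> (\<forall>j<n. w ! j < T * (B + 1)) \<and> (\<forall>i<d. int T dvd app w i)
    \<and> card {y \<in> sols (\<lambda>i. app w i div int T). \<forall>j<n. y ! j \<le> 2 * B} < k"

text \<open>From left to right, \<open>T b = A p\<close> is split by dividing \<open>p\<close> by
  \<open>T\<close> and capping the quotients at \<open>B\<close>, the excess going to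
  \<open>z\<close>. From right to left, \<open>few_extend\<close> applies to
  \<open>u = w mod T\<close> and \<open>x = w div T\<close>.\<close>

lemma holes_iff:
  "in_cone b \<and> few b \<longleftrightarrow> (\<exists>w z. code w \<and> length z = n \<and> (\<forall>j<n. z ! j \<noteq> 0 \<longrightarrow> T * B \<le> w ! j)
    \<and> (\<forall>i<d. b i = app w i div int T + app z i))"
proof
  assume b: "in_cone b \<and> few b"
  then obtain \<mu> where \<mu>: "\<forall>j<n. 0 \<le> \<mu> j"
      "\<forall>i<d. real_of_int (b i) = (\<Sum>j<n. real_of_int (a i j) * \<mu> j)"
    unfolding in_cone_def by blast
  obtain p where "\<And>i. i < d \<Longrightarrow> int T * b i = (\<Sum>j<n. a i j * int (p j))"
    unfolding T_def by (rule cone_denominator[OF row_sum c_pos, where b = b and \<mu> = \<mu>]) (use \<mu> in auto)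
  then have p: "int T * b i = (\<Sum>j<n. a i j * int (p j mod T + T * (p j div T)))" if "i < d" for i
    using that by simp
  define w where "w = map (\<lambda>j. p j mod T + T * min (p j div T) B) [0..<n]"
  define z where "z = map (\<lambda>j. p j div T - B) [0..<n]"
  have split: "app w i = int T * (b i - app z i)" if "i < d" for i
  proof -
    have "int (p j mod T + T * (p j div T)) = int (w ! j) + int T * int (z ! j)" if "j < n" for j
    proof -
      have "p j div T = min (p j div T) B + (p j div T - B)" by simp
      then have "T * (p j div T) = T * min (p j div T) B + T * (p j div T - B)"
        by (metis distrib_left)
      then have "p j mod T + T * (p j div T) = w ! j + T * z ! j"
        using that by (simp only: w_def z_def nth_map length_upt nth_upt minus_nat.diff_0 add_0)
      then show ?thesis by (simp only: of_nat_add of_nat_mult)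
    qed
    then have "int T * b i = (\<Sum>j<n. a i j * (int (w ! j) + int T * int (z ! j)))"
      unfolding p[OF that] by (intro sum.cong refl) (simp only: lessThan_iff)
    also have "\<dots> = app w i + int T * app z i"
      by (simp add: app_def sum.distrib sum_distrib_left algebra_simps)
    finally show ?thesis by (simp add: algebra_simps)
  qed
  then have div: "app w i div int T = b i - app z i" if "i < d" for i
    using that T_pos by simp
  have w: "w ! j < T * (B + 1)" if "j < n" for j
  proof -
    have "w ! j < T + T * min (p j div T) B" using that T_pos by (simp add: w_def)
    also have "\<dots> \<le> T + T * B" by simp
    finally show ?thesis by simp
  qed
  have sols: "sols (\<lambda>i. app w i div int T) = sols (\<lambda>i. b i - app z i)"
    using div by (auto simp: sols_def)
  \<comment> \<open>Moving down by \<open>A z\<close> keeps the number of preimages below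
    \<open>k\<close>, and the box contains only some of them.\<close>
  have "few (\<lambda>i. b i - app z i)"
    using b by (simp add: few_antimono[of _ z])
  then have "card {y \<in> sols (\<lambda>i. b i - app z i). \<forall>j<n. y ! j \<le> 2 * B} < k"
    using card_mono[of "sols (\<lambda>i. b i - app z i)" "{y \<in> sols (\<lambda>i. b i - app z i). \<forall>j<n. y ! j \<le> 2 * B}"]
    by (auto simp: few_def)
  then have "code w"
    unfolding code_def sols using w split by (auto simp: w_def)
  moreover have "T * B \<le> w ! j" if "j < n" "z ! j \<noteq> 0" for j
    using that by (simp add: w_def z_def min_def trans_le_add2)
  ultimately show "\<exists>w z. code w \<and> length z = n \<and> (\<forall>j<n. z ! j \<noteq> 0 \<longrightarrow> T * B \<le> w ! j)
      \<and> (\<forall>i<d. b i = app w i div int T + app z i)"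
    using div by (intro exI[of _ w] exI[of _ z]) (auto simp: z_def)
next
  assume "\<exists>w z. code w \<and> length z = n \<and> (\<forall>j<n. z ! j \<noteq> 0 \<longrightarrow> T * B \<le> w ! j)
    \<and> (\<forall>i<d. b i = app w i div int T + app z i)"
  then obtain w z where w: "code w" and z: "\<And>j. j < n \<Longrightarrow> z ! j \<noteq> 0 \<Longrightarrow> T * B \<le> w ! j"
    and b: "\<And>i. i < d \<Longrightarrow> b i = app w i div int T + app z i"
    by blast
  define x where "x = map (\<lambda>j. w ! j div T) [0..<n]"
  \<comment> \<open>\<open>f\<close> is \<open>A u / T\<close> for \<open>u = w mod T\<close>. As
    \<open>u < T\<close>, the row sums bound it by \<open>c\<close>, as \<open>few_extend\<close>
    requires.\<close>
  define f where "f i = app w i div int T - app x i" for i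
  have x: "x ! j \<le> B" if "j < n" for j
  proof -
    have "w ! j div T < B + 1"
      using w that T_pos by (simp add: code_def div_less_iff_less_mult mult.commute)
    then show ?thesis using that by (simp add: x_def)
  qed
  have dvd: "int T * (app w i div int T) = app w i" if "i < d" for i
    using w that by (simp add: code_def)
  have f: "\<bar>f i\<bar> \<le> int c" if "i < d" for i
  proof -
    have "int T * f i = app w i - int T * app x i"
      using dvd[OF that] by (simp add: f_def right_diff_distrib)
    also have "\<dots> = (\<Sum>j<n. a i j * int (w ! j mod T))"
      by (simp add: app_def x_def sum_distrib_left flip: sum_subtractf)
         (rule sum.cong, auto simp: zmod_int zdiv_int minus_mult_div_eq_mod[symmetric] algebra_simps)
    also have "\<bar>\<dots>\<bar> \<le> (\<Sum>j<n. \<bar>a i j\<bar> * int T)"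
      using T_pos by (intro order_trans[OF sum_abs] sum_mono) (simp add: abs_mult mult_left_mono less_imp_le)
    also have "\<dots> = int T * (\<Sum>j<n. \<bar>a i j\<bar>)" by (simp add: sum_distrib_left mult.commute)
    also have "\<dots> \<le> int T * int c" using row_sum[OF that] by (intro mult_left_mono) auto
    finally show ?thesis using T_pos by (simp add: abs_mult)
  qed
  have "few (\<lambda>i. f i + app x i + app z i)"
  proof (rule few_extend[OF f x])
    show "card {y \<in> sols (\<lambda>i. f i + app x i). \<forall>j<n. y ! j \<le> 2 * B} < k"
      using w by (simp add: f_def code_def)
    show "x ! j = B" if "j < n" "z ! j \<noteq> 0" for j
    proof (rule antisym[OF x[OF that(1)]])
      show "B \<le> x ! j"
        using z[OF that] that(1) T_pos by (simp add: x_def less_eq_div_iff_mult_less_eq mult.commute)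
    qed
  qed
  moreover have "sols b = sols (\<lambda>i. f i + app x i + app z i)"
    using b by (auto simp: sols_def f_def)
  ultimately have "few b" by (simp add: few_def)
  moreover have "in_cone b"
    unfolding in_cone_def
  \<comment> \<open>The cone coefficients are \<open>w / T + z\<close>, because
    \<open>b = A w / T + A z\<close>.\<close>
  proof (intro exI[of _ "\<lambda>j. real (w ! j) / real T + real (z ! j)"] conjI allI impI)
    fix i assume i: "i < d"
    have "real T * real_of_int (b i) = real_of_int (int T * b i)" by simp
    also have "int T * b i = app w i + int T * app z i"
      using dvd[OF i] by (simp add: b[OF i] distrib_left)
    also have "real_of_int \<dots> = real T * (\<Sum>j<n. real_of_int (a i j) * (real (w ! j) / real T + real (z ! j)))"
      using T_pos by (simp add: app_def sum.distrib sum_distrib_left algebra_simps)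
    finally show "real_of_int (b i)
        = (\<Sum>j<n. real_of_int (a i j) * (real (w ! j) / real T + real (z ! j)))"
      using T_pos by simp
  qed auto
  ultimately show "in_cone b \<and> few b" by blast
qed

end

unbundle no vec_syntax

section \<open>The algorithm\<close>

text \<open>Throughout, \<open>d\<close> is the number of rows and \<open>L\<close> the list of columns of the matrix.\<close>

definition coef :: "int list list \<Rightarrow> nat \<Rightarrow> nat \<Rightarrow> int" where
  "coef L i j = entry 0 (entry [] L j) i"

text \<open>One sum over all entries bounds every row sum; \<open>Suc\<close> makes the bound strict
  and positive.\<close>

definition coef_bound :: "nat \<Rightarrow> int list list \<Rightarrow> nat" where
  "coef_bound d L = Suc (nat (\<Sum>j<length L. \<Sum>i<d. \<bar>coef L i j\<bar>))"

definition denominator :: "nat \<Rightarrow> int list list \<Rightarrow> nat" where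
  "denominator d L = fact (coef_bound d L ^ length L)"

definition box_bound :: "nat \<Rightarrow> nat \<Rightarrow> int list list \<Rightarrow> nat" where
  "box_bound k d L = piece_bound (coef_bound d L) (k * d + k * k)"

definition dot :: "int list list \<Rightarrow> nat list \<Rightarrow> nat \<Rightarrow> int" where
  "dot L w i = (\<Sum>j<length L. coef L i j * int (entry 0 w j))"

text \<open>The preimages of \<open>A w / T\<close> in the box \<open>{0..2 B}\<close>, with the
  denominator cleared.\<close>

definition solutions :: "nat \<Rightarrow> nat \<Rightarrow> int list list \<Rightarrow> nat list \<Rightarrow> nat list list" where
  "solutions k d L w = filter (\<lambda>y. \<forall>i<d. int (denominator d L) * dot L y i = dot L w i)
    (List.n_lists (length L) [0..<Suc (2 * box_bound k d L)])"

definition codes :: "nat \<Rightarrow> nat \<Rightarrow> int list list \<Rightarrow> nat list list" where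
  "codes k d L = filter (\<lambda>w. (\<forall>i<d. int (denominator d L) * quot (dot L w i) (denominator d L) = dot L w i)
      \<and> length (solutions k d L w) < k)
    (List.n_lists (length L) [0..<denominator d L * (box_bound k d L + 1)])"

text \<open>Each code contributes the translation \<open>A w / T\<close> and, as generators, the
  columns whose coordinate of \<open>x = w div T\<close> has reached \<open>B\<close>.\<close>

definition holes_rep :: "nat \<Rightarrow> nat \<Rightarrow> int list list \<Rightarrow> (int list \<times> int list list) list" where
  "holes_rep k d L = map (\<lambda>w. (map (\<lambda>i. quot (dot L w i) (denominator d L)) [0..<d],
      map (\<lambda>j. entry [] L j)
        (filter (\<lambda>j. denominator d L * box_bound k d L \<le> entry 0 w j) [0..<length L])))
    (codes k d L)"

section \<open>Computability of the search\<close>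

lemma computable_coef [computable_intros]:
  "computable L \<Longrightarrow> computable i \<Longrightarrow> computable j \<Longrightarrow> computable (\<lambda>x. coef (L x) (i x) (j x))"
  unfolding coef_def by (intro computable_intros)

lemma computable_coef_bound [computable_intros]:
  assumes "computable d" and "computable L"
  shows "computable (\<lambda>x. coef_bound (d x) (L x))"
  \<comment> \<open>Under a binder \<open>d\<close> and \<open>L\<close> are applied to a projection
    of the enlarged argument; composing the assumptions with projections covers these
    occurrences.\<close>
  unfolding coef_bound_def by (intro computable_intros assms assms[THEN computable_comp])

lemma computable_denominator [computable_intros]:
  "computable d \<Longrightarrow> computable L \<Longrightarrow> computable (\<lambda>x. denominator (d x) (L x))"
  unfolding denominator_def by (intro computable_intros)

lemma computable_box_bound [computable_intros]:
  assumes "computable d" and "computable L"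
  shows "computable (\<lambda>x. box_bound k (d x) (L x))"
  unfolding box_bound_def piece_bound_def
  by (intro computable_intros assms assms[THEN computable_comp])

lemma computable_dot [computable_intros]:
  assumes "computable L" and "computable w" and "computable i"
  shows "computable (\<lambda>x. dot (L x) (w x) (i x))"
  unfolding dot_def by (intro computable_intros assms assms[THEN computable_comp])

lemma computable_solutions [computable_intros]:
  assumes "computable d" and "computable L" and "computable w"
  shows "computable (\<lambda>x. solutions k (d x) (L x) (w x))"
  unfolding solutions_def by (intro computable_intros assms assms[THEN computable_comp])

lemma computable_codes [computable_intros]:
  assumes "computable d" and "computable L"
  shows "computable (\<lambda>x. codes k (d x) (L x))"
  unfolding codes_def by (intro computable_intros assms assms[THEN computable_comp])

lemma computable_holes_rep: "computable (\<lambda>p. holes_rep k (fst p) (snd p))"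
  unfolding holes_rep_def by (intro computable_intros)

section \<open>Correctness of the search\<close>

lemma mult_quot_eq_iff:
  assumes "T > 0"
  shows "int T * quot i T = i \<longleftrightarrow> int T dvd i"
proof
  assume "int T dvd i"
  then show "int T * quot i T = i" using quot_mult[OF assms] by (auto elim!: dvdE)
qed (metis dvd_triv_left)

lemma set_n_lists_upt: "set (List.n_lists n [0..<m]) = {w. length w = n \<and> (\<forall>j<n. w ! j < m)}"
  by (auto simp: set_n_lists in_set_conv_nth subset_iff)

lemma hole_problem_coef:
  "hole_problem (coef L) d (length L) k (coef_bound d L) (denominator d L) (box_bound k d L)"
proof
  fix i assume i: "i < d"
  have "(\<Sum>j<length L. \<bar>coef L i j\<bar>) \<le> (\<Sum>j<length L. \<Sum>i<d. \<bar>coef L i j\<bar>)"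
    using i by (intro sum_mono member_le_sum) auto
  then show "(\<Sum>j<length L. \<bar>coef L i j\<bar>) < int (coef_bound d L)"
    unfolding coef_bound_def by linarith
qed (simp_all add: coef_bound_def denominator_def box_bound_def)

context
  fixes k d :: nat and L :: "int list list"
begin

interpretation hole_problem "coef L" d "length L" k "coef_bound d L" "denominator d L" "box_bound k d L"
  by (rule hole_problem_coef)

lemma dot_eq_app: "length w = length L \<Longrightarrow> dot L w i = app w i"
  by (simp add: dot_def app_def entry_def)

text \<open>The enumerated lists are distinct, so the length of the filtered list is the cardinality
  in \<open>code\<close>; multiplying back after \<open>quot\<close> tests divisibility.\<close>

lemma set_codes: "set (codes k d L) = {w. code w}"
proof -
  let ?T = "denominator d L" and ?B = "box_bound k d L"
  have "length (solutions k d L w)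
      = card {y \<in> sols (\<lambda>i. app w i div int ?T). \<forall>j<length L. y ! j \<le> 2 * ?B}"
    if w: "length w = length L" "\<forall>i<d. int ?T dvd app w i" for w
  proof -
    have "int ?T * u = app w i \<longleftrightarrow> u = app w i div int ?T" if "i < d" for u i
    proof -
      obtain q where "app w i = int ?T * q" using w(2) \<open>i < d\<close> unfolding dvd_def by blast
      then show ?thesis using T_pos by auto
    qed
    then have "(\<forall>i<d. int ?T * dot L y i = dot L w i) \<longleftrightarrow> (\<forall>i<d. app y i = app w i div int ?T)"
      if "length y = length L" for y
      using that w(1) by (simp add: dot_eq_app)
    then have "{y. \<forall>i<d. int ?T * dot L y i = dot L w i} \<inter> set (List.n_lists (length L) [0..<Suc (2 * ?B)])
        = {y \<in> sols (\<lambda>i. app w i div int ?T). \<forall>j<length L. y ! j \<le> 2 * ?B}"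
      by (auto simp: set_n_lists_upt sols_def less_Suc_eq_le simp del: upt_Suc)
    then show ?thesis
      unfolding solutions_def by (subst distinct_length_filter) (auto intro: distinct_n_lists)
  qed
  then show ?thesis
    using mult_quot_eq_iff[OF T_pos]
    by (auto simp: codes_def code_def set_n_lists_upt dot_eq_app)
qed

lemma holes_rep_iff:
  "in_cone b \<and> few b \<longleftrightarrow> (\<exists>w\<in>set (codes k d L). \<exists>z. length z = length L
    \<and> (\<forall>j<length L. z ! j \<noteq> 0 \<longrightarrow> denominator d L * box_bound k d L \<le> entry 0 w j)
    \<and> (\<forall>i<d. b i = quot (dot L w i) (denominator d L) + app z i))"
proof -
  have "quot (dot L w i) (denominator d L) = app w i div int (denominator d L)"
    if "code w" "i < d" for w i
  proof -
    have "int (denominator d L) dvd app w i" "length w = length L" using that by (auto simp: code_def)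
    then show ?thesis using quot_mult[OF T_pos] T_pos by (auto simp: dot_eq_app elim!: dvdE)
  qed
  moreover have "entry 0 w j = w ! j" if "code w" "j < length L" for w j
    using that by (simp add: entry_def code_def)
  ultimately show ?thesis
    unfolding holes_iff set_codes by (simp cong: conj_cong)
qed

end

section \<open>Transfer to matrices and vectors\<close>

lemma mult_mat_vec_index:
  assumes "A \<in> carrier_mat d n" "x \<in> carrier_vec n" "i < d"
  shows "(A *\<^sub>v x) $ i = (\<Sum>j<n. A $$ (i, j) * x $ j)"
  using assms by (simp add: scalar_prod_def atLeast0LessThan)

text \<open>Combinations of selected columns are the combinations of all columns whose coefficients
  vanish outside the selection. This matches the semigroups of the representation with the vectors
  \<open>z\<close> of \<open>holes_iff\<close>.\<close>

lemma Sg_columns: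
  fixes A :: "int mat"
  assumes A: "A \<in> carrier_mat d n" and js: "distinct js" "set js \<subseteq> {..<n}"
  shows "Sg (mat_of_cols d (map (col A) js)) =
    {vec d (\<lambda>i. \<Sum>j<n. A $$ (i, j) * int (z ! j)) | z. length z = n \<and> (\<forall>j<n. z ! j \<noteq> 0 \<longrightarrow> j \<in> set js)}"
    (is "?L = ?R")
proof -
  let ?M = "mat_of_cols d (map (col A) js)" and ?m = "length js"
  have M: "?M \<in> carrier_mat d ?m" using mat_of_cols_carrier(1)[of d "map (col A) js"] by simp
  have bij: "bij_betw (\<lambda>m. js ! m) {..<?m} (set js)" using js(1) by (rule bij_betw_nth) auto
  have eq: "?M *\<^sub>v x = vec d (\<lambda>i. \<Sum>j<n. A $$ (i, j) * int (z ! j))"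
    if x: "x \<in> carrier_vec ?m" "\<And>m. m < ?m \<Longrightarrow> x $ m = int (z ! (js ! m))"
      and z: "\<And>j. j < n \<Longrightarrow> z ! j \<noteq> 0 \<Longrightarrow> j \<in> set js" for x z
  proof (rule eq_vecI)
    fix i assume "i < dim_vec (vec d (\<lambda>i. \<Sum>j<n. A $$ (i, j) * int (z ! j)))"
    then have i: "i < d" by simp
    have "?M $$ (i, m) = A $$ (i, js ! m)" if "m < ?m" for m
      using that i A js(2) by (auto simp: mat_of_cols_index subset_iff)
    then have "(?M *\<^sub>v x) $ i = (\<Sum>m<?m. A $$ (i, js ! m) * int (z ! (js ! m)))"
      unfolding mult_mat_vec_index[OF M x(1) i] using x(2) by (intro sum.cong) auto
    also have "\<dots> = (\<Sum>j\<in>set js. A $$ (i, j) * int (z ! j))"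
      by (rule sum.reindex_bij_betw[OF bij])
    also have "\<dots> = (\<Sum>j<n. A $$ (i, j) * int (z ! j))"
      using js(2) z by (intro sum.mono_neutral_left) auto
    finally show "(?M *\<^sub>v x) $ i = vec d (\<lambda>i. \<Sum>j<n. A $$ (i, j) * int (z ! j)) $ i"
      using i by simp
  qed simp
  show ?thesis
  proof (intro subset_antisym subsetI)
    fix v assume "v \<in> ?L"
    then obtain x where x: "x \<in> carrier_vec ?m" "0\<^sub>v ?m \<le> x" and v: "v = ?M *\<^sub>v x"
      by (auto simp: Sg_def)
    \<comment> \<open>\<open>ix\<close> recovers the position of a column in the distinct list
      \<open>js\<close>; it lets \<open>z\<close> spread the coefficients over all \<open>n\<close>
      columns, with 0 elsewhere.\<close>
    define ix where "ix = the_inv_into {..<?m} (\<lambda>m. js ! m)"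
    have ix: "ix (js ! m) = m" if "m < ?m" for m
      unfolding ix_def using bij that by (intro the_inv_into_f_f) (auto simp: bij_betw_def)
    define z where "z = map (\<lambda>j. if j \<in> set js then nat (x $ ix j) else 0) [0..<n]"
    have z: "z ! j = (if j \<in> set js then nat (x $ ix j) else 0)" if "j < n" for j
      using that by (simp add: z_def)
    have "v = vec d (\<lambda>i. \<Sum>j<n. A $$ (i, j) * int (z ! j))"
      unfolding v
    proof (rule eq[OF x(1)])
      fix m assume m: "m < ?m"
      then have "js ! m < n" using js(2) by (meson lessThan_iff nth_mem subsetD)
      moreover have "0 \<le> x $ m" using x m by (auto simp: less_eq_vec_def)
      ultimately show "x $ m = int (z ! (js ! m))" using m by (simp add: z ix)
    qed (simp add: z split: if_splits)
    moreover have "\<forall>j<n. z ! j \<noteq> 0 \<longrightarrow> j \<in> set js" by (simp add: z)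
    moreover have "length z = n" by (simp add: z_def)
    ultimately show "v \<in> ?R" by blast
  next
    fix v assume "v \<in> ?R"
    then obtain z where z: "\<And>j. j < n \<Longrightarrow> z ! j \<noteq> 0 \<Longrightarrow> j \<in> set js"
      and v: "v = vec d (\<lambda>i. \<Sum>j<n. A $$ (i, j) * int (z ! j))"
      by blast
    have "?M *\<^sub>v vec ?m (\<lambda>m. int (z ! (js ! m))) = v"
      unfolding v by (rule eq) (use z in auto)
    then show "v \<in> ?L"
      unfolding Sg_def by (intro CollectI exI[of _ "vec ?m (\<lambda>m. int (z ! (js ! m)))"])
        (auto simp: less_eq_vec_def)
  qed
qed

lemma Sg_less_iff:
  assumes A: "A \<in> carrier_mat d n" and "hole_problem a d n k c T B"
    and a: "\<And>i j. i < d \<Longrightarrow> j < n \<Longrightarrow> a i j = A $$ (i, j)"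
    and b: "b \<in> carrier_vec d"
  shows "b \<in> Sg_less k A \<longleftrightarrow> hole_problem.in_cone a d n (\<lambda>i. b $ i) \<and> hole_problem.few a d n k (\<lambda>i. b $ i)"
proof -
  interpret hole_problem a d n k c T B by fact
  let ?A = "map_mat real_of_int A"
  have "map_vec real_of_int b \<in> cone_of A \<longleftrightarrow> in_cone (\<lambda>i. b $ i)"
  proof -
    have eq: "map_vec real_of_int b = ?A *\<^sub>v x \<longleftrightarrow>
        (\<forall>i<d. real_of_int (b $ i) = (\<Sum>j<n. real_of_int (a i j) * x $ j))"
      if x: "x \<in> carrier_vec n" for x
    proof -
      have "(?A *\<^sub>v x) $ i = (\<Sum>j<n. real_of_int (a i j) * x $ j)" if "i < d" for i
        using mult_mat_vec_index[of ?A d n x i] A x that by (simp add: a)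
      then show ?thesis using b A by (auto simp: vec_eq_iff)
    qed
    show ?thesis
    proof
      assume "map_vec real_of_int b \<in> cone_of A"
      then obtain x where "x \<in> carrier_vec n" "0\<^sub>v n \<le> x" "map_vec real_of_int b = ?A *\<^sub>v x"
        using A by (auto simp: cone_of_def)
      then show "in_cone (\<lambda>i. b $ i)"
        unfolding in_cone_def by (intro exI[of _ "\<lambda>j. x $ j"]) (auto simp: eq less_eq_vec_def)
    next
      assume "in_cone (\<lambda>i. b $ i)"
      then obtain \<mu> where "\<forall>j<n. 0 \<le> \<mu> j"
          "\<forall>i<d. real_of_int (b $ i) = (\<Sum>j<n. real_of_int (a i j) * \<mu> j)"
        unfolding in_cone_def by blast
      moreover from this have "map_vec real_of_int b = ?A *\<^sub>v vec n \<mu>"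
        by (subst eq) auto
      ultimately show "map_vec real_of_int b \<in> cone_of A"
        using A unfolding cone_of_def by (intro CollectI exI[of _ "vec n \<mu>"]) (auto simp: less_eq_vec_def)
    qed
  qed
  \<comment> \<open>Lists of naturals correspond to nonnegative integer vectors; the bijection
    transfers both finiteness and cardinality of the fibre.\<close>
  moreover have "bij_betw (\<lambda>y. vec n (\<lambda>j. int (y ! j))) (sols (\<lambda>i. b $ i)) (fiber A b)"
  proof (rule bij_betw_byWitness[where f' = "\<lambda>x. map (\<lambda>j. nat (x $ j)) [0..<n]"])
    have app: "(A *\<^sub>v vec n (\<lambda>j. int (y ! j))) $ i = app y i" if "i < d" for y i
      using mult_mat_vec_index[of A d n "vec n (\<lambda>j. int (y ! j))" i] A that by (simp add: a app_def)
    show "\<forall>y\<in>sols (\<lambda>i. b $ i). map (\<lambda>j. nat (vec n (\<lambda>j. int (y ! j)) $ j)) [0..<n] = y"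
      by (auto simp: sols_def intro!: nth_equalityI)
    have inv: "vec n (\<lambda>j. int (map (\<lambda>j. nat (x $ j)) [0..<n] ! j)) = x" if "x \<in> fiber A b" for x
    proof (rule eq_vecI)
      have x: "x \<in> carrier_vec n" "0\<^sub>v n \<le> x" using that A by (auto simp: fiber_def)
      show "dim_vec (vec n (\<lambda>j. int (map (\<lambda>j. nat (x $ j)) [0..<n] ! j))) = dim_vec x"
        using x(1) by simp
      show "vec n (\<lambda>j. int (map (\<lambda>j. nat (x $ j)) [0..<n] ! j)) $ j = x $ j" if "j < dim_vec x" for j
        using x that by (auto simp: less_eq_vec_def)
    qed
    then show "\<forall>x\<in>fiber A b. vec n (\<lambda>j. int (map (\<lambda>j. nat (x $ j)) [0..<n] ! j)) = x"
      by blast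
    show "(\<lambda>y. vec n (\<lambda>j. int (y ! j))) ` sols (\<lambda>i. b $ i) \<subseteq> fiber A b"
    proof
      fix x assume "x \<in> (\<lambda>y. vec n (\<lambda>j. int (y ! j))) ` sols (\<lambda>i. b $ i)"
      then obtain y where y: "y \<in> sols (\<lambda>i. b $ i)" and x: "x = vec n (\<lambda>j. int (y ! j))" by blast
      have "A *\<^sub>v x = b"
        unfolding x using A b app y by (intro eq_vecI) (auto simp: sols_def simp del: index_mult_mat_vec)
      then show "x \<in> fiber A b" using A by (simp add: fiber_def x less_eq_vec_def)
    qed
    show "(\<lambda>x. map (\<lambda>j. nat (x $ j)) [0..<n]) ` fiber A b \<subseteq> sols (\<lambda>i. b $ i)"
    proof
      fix y assume "y \<in> (\<lambda>x. map (\<lambda>j. nat (x $ j)) [0..<n]) ` fiber A b"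
      then obtain x where x: "x \<in> fiber A b" and y: "y = map (\<lambda>j. nat (x $ j)) [0..<n]" by blast
      have "A *\<^sub>v vec n (\<lambda>j. int (y ! j)) = b"
        unfolding y inv[OF x] using x by (simp add: fiber_def)
      then show "y \<in> sols (\<lambda>i. b $ i)"
        using app[of _ y] by (auto simp: sols_def y simp del: index_mult_mat_vec)
    qed
  qed
  then have "finite (fiber A b) \<and> card (fiber A b) < k \<longleftrightarrow> few (\<lambda>i. b $ i)"
    unfolding few_def using bij_betw_finite bij_betw_same_card by metis
  ultimately show ?thesis
    using A b by (simp add: Sg_less_def)
qed

theorem theorem4:
  fixes k :: nat
  assumes "k \<ge> 1"
  shows "\<exists>p :: recf. \<forall>d n. \<forall>A \<in> carrier_mat d n. pointed (cone_of A) \<longrightarrow>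
    (\<exists>R. rec_eval p [encode_mat A] (encode_rep R) \<and> rep_wf d R \<and> Sg_less k A = rep_set d R)"
proof -
  \<comment> \<open>The program is fixed here, knowing only \<open>k\<close>, before any dimensions
    or matrix are given.\<close>
  obtain p where p: "\<And>d L. rec_eval p [encode (d, L)] (encode (holes_rep k d L))"
    using computable_holes_rep[of k] unfolding computable_def by (metis fst_conv snd_conv)
  have "\<exists>R. rec_eval p [encode_mat A] (encode_rep R) \<and> rep_wf d R \<and> Sg_less k A = rep_set d R"
    if A: "A \<in> carrier_mat d n" for d n and A :: "int mat"
  proof -
    define L where "L = map list_of_vec (cols A)"
    define R where "R = map (\<lambda>(h, G). (vec_of_list h, map vec_of_list G)) (holes_rep k d L)"
    let ?T = "denominator d L" and ?B = "box_bound k d L"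
    have len: "length L = n" using A by (simp add: L_def)
    interpret hole_problem "coef L" d n k "coef_bound d L" ?T ?B
      using hole_problem_coef[of L d k] by (simp only: len)
    have col: "vec_of_list (entry [] L j) = col A j" if "j < n" for j
      using that A by (simp add: entry_def L_def vec_list)
    have coef: "coef L i j = A $$ (i, j)" if "i < d" "j < n" for i j
    proof -
      have "coef L i j = vec_of_list (entry [] L j) $ i"
        using that A by (simp add: coef_def entry_def L_def vec_list list_of_vec_index)
      then show ?thesis using that A by (simp add: col)
    qed
    have "encode_vec v = encode (list_of_vec v)" for v
      by (simp add: encode_vec_def encode_list_def encode_int_def[abs_def])
    then have vec: "encode_vec = (\<lambda>v. encode (list_of_vec v))" by blast
    \<comment> \<open>The matrix and the pair of row number and column lists have the same code, so
      \<open>p\<close> runs on the matrix itself; likewise for the output.\<close>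
    have enc_A: "encode_mat A = encode (d, L)"
      using A by (simp add: encode_mat_def encode_Pair encode_list_def L_def vec comp_def)
    have enc_R: "encode_rep R = encode (holes_rep k d L)"
      unfolding encode_rep_def encode_list_def[of "holes_rep k d L"] R_def vec
      by (simp add: comp_def split_def map_prod_def encode_prod_def[abs_def] encode_list_def[abs_def] list_vec)
    have "rec_eval p [encode_mat A] (encode_rep R)"
      unfolding enc_A enc_R by (rule p)
    moreover have R: "set R = (\<lambda>w. (vec d (\<lambda>i. quot (dot L w i) ?T),
        map (col A) (filter (\<lambda>j. ?T * ?B \<le> entry 0 w j) [0..<n]))) ` set (codes k d L)"
    proof -
      have "vec_of_list (map f [0..<d]) = vec d f" for f :: "nat \<Rightarrow> int"
        by (intro eq_vecI) (auto simp: vec_of_list_index)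
      then show ?thesis
        unfolding R_def holes_rep_def by (auto simp: image_image len comp_def col intro!: image_cong)
    qed
    have "col A j \<in> carrier_vec d" for j
      using A by (simp add: carrier_vecI)
    then have "set (map (col A) js) \<subseteq> carrier_vec d" for js
      by (simp add: image_subset_iff)
    then have "rep_wf d R"
      unfolding rep_wf_def R by (auto simp del: set_map)
    moreover have "Sg_less k A = rep_set d R"
    proof (rule Set.set_eqI)
      fix b
      have "b \<in> rep_set d R \<longleftrightarrow> (\<exists>w\<in>set (codes k d L). \<exists>m\<in>Sg (mat_of_cols d
          (map (col A) (filter (\<lambda>j. ?T * ?B \<le> entry 0 w j) [0..<n]))). b = vec d (\<lambda>i. quot (dot L w i) ?T) + m)"
        unfolding rep_set_def R by auto
      also have "\<dots> \<longleftrightarrow> (\<exists>w\<in>set (codes k d L). \<exists>z. length z = n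
          \<and> (\<forall>j<n. z ! j \<noteq> 0 \<longrightarrow> ?T * ?B \<le> entry 0 w j)
          \<and> b = vec d (\<lambda>i. quot (dot L w i) ?T) + vec d (\<lambda>i. \<Sum>j<n. A $$ (i, j) * int (z ! j)))"
        by (subst Sg_columns[OF A]) auto
      also have "\<dots> \<longleftrightarrow> b \<in> carrier_vec d \<and> (\<exists>w\<in>set (codes k d L). \<exists>z. length z = n
          \<and> (\<forall>j<n. z ! j \<noteq> 0 \<longrightarrow> ?T * ?B \<le> entry 0 w j)
          \<and> (\<forall>i<d. b $ i = quot (dot L w i) ?T + app z i))"
      proof -
        have "b = vec d (\<lambda>i. quot (dot L w i) ?T) + vec d (\<lambda>i. \<Sum>j<n. A $$ (i, j) * int (z ! j))
            \<longleftrightarrow> b \<in> carrier_vec d \<and> (\<forall>i<d. b $ i = quot (dot L w i) ?T + app z i)" for w z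
          by (auto simp: vec_eq_iff app_def coef)
        then show ?thesis by blast
      qed
      also have "\<dots> \<longleftrightarrow> b \<in> carrier_vec d \<and> in_cone (\<lambda>i. b $ i) \<and> few (\<lambda>i. b $ i)"
        using holes_rep_iff[where L = L and d = d and k = k and b = "\<lambda>i. b $ i"] by (simp only: len)
      also have "\<dots> \<longleftrightarrow> b \<in> Sg_less k A"
        using Sg_less_iff[OF A hole_problem_axioms coef] A by (auto simp: Sg_less_def)
      finally show "b \<in> Sg_less k A \<longleftrightarrow> b \<in> rep_set d R" by simp
    qed
    ultimately show ?thesis by blast
  qed
  then show ?thesis by blast
qed

end
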